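(* There is an algorithm that, given a finite metric space $(X,d)$ with $n=|X|$ points and an integer $k\ge 1$, solves the Min-Sum-Diameters (MSD) problem with $k$ clusters exactly in time $n^{O(k)}$.
   Context: Min-Sum-Diameters (MSD): given a finite metric space $(X,d)$ and an integer $k$, partition $X$ into at most $k$ disjoint nonempty clusters $C_1,\dots,C_k$ so as to minimize $\sum_i \operatorname{diam}(C_i)$, where $\operatorname{diam}(C)=\max_{x,y\in C}d(x,y)$. The metric is arbitrary (general metric spaces). *)

theory Defs
  imports "HOL-Analysis.Analysis" "HOL-Library.Disjoint_Sets"
begin

section \<open>Min-Sum-Diameters\<close>

definition diam :: "('a \<Rightarrow> 'a \<Rightarrow> real) \<Rightarrow> 'a set \<Rightarrow> real" where
  "diam d C = Max {d x y | x y. x \<in> C \<and> y \<in> C}"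

definition sum_diam :: "('a \<Rightarrow> 'a \<Rightarrow> real) \<Rightarrow> 'a set set \<Rightarrow> real" where
  "sum_diam d P = (\<Sum>C\<in>P. diam d C)"

definition clustering :: "'a set \<Rightarrow> nat \<Rightarrow> 'a set set \<Rightarrow> bool" where
  "clustering X k P \<longleftrightarrow> partition_on X P \<and> card P \<le> k"

definition msd_optimal :: "'a set \<Rightarrow> ('a \<Rightarrow> 'a \<Rightarrow> real) \<Rightarrow> nat \<Rightarrow> 'a set set \<Rightarrow> bool" where
  "msd_optimal X d k P \<longleftrightarrow>
     clustering X k P \<and> (\<forall>Q. clustering X k Q \<longrightarrow> sum_diam d P \<le> sum_diam d Q)"


section \<open>Machine model: a structured real RAM\<close>

text \<open>
  Integer cells hold natural numbers and real cells hold real numbers; arrays are indexed by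
  natural numbers, so indirect addressing is available. Every elementary operation has unit cost.
  The arithmetic is limited to addition, subtraction and comparison, on naturals (where subtraction
  is truncated) as well as on reals. In particular there is no multiplication, which at unit cost
  and on unbounded naturals would make the model unrealistically strong, and there is no conversion
  between real and integer cells. Programs contain no real constants.
\<close>

type_synonym vname = string

datatype nexp =
    NConst nat
  | NVar vname
  | NArr vname nexp
  | NAdd nexp nexp
  | NSub nexp nexp

datatype rexp =
    RVar vname
  | RArr vname nexp
  | RAdd rexp rexp
  | RSub rexp rexp

datatype bexp =
    NLess nexp nexp
  | RLess rexp rexp
  | BNot bexp
  | BAnd bexp bexp

datatype com =
    Skip
  | NAssign vname nexp
  | NStore vname nexp nexp  \<comment> \<open>array, index, value\<close>
  | RAssign vname rexp
  | RStore vname nexp rexp  \<comment> \<open>array, index, value\<close>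
  | Seq com com
  | Cond bexp com com
  | While bexp com

record state =
  nvar :: "vname \<Rightarrow> nat"
  narr :: "vname \<Rightarrow> nat \<Rightarrow> nat"
  rvar :: "vname \<Rightarrow> real"
  rarr :: "vname \<Rightarrow> nat \<Rightarrow> real"

primrec nval :: "nexp \<Rightarrow> state \<Rightarrow> nat" where
  "nval (NConst m) s = m"
| "nval (NVar x) s = nvar s x"
| "nval (NArr a e) s = narr s a (nval e s)"
| "nval (NAdd e f) s = nval e s + nval f s"
| "nval (NSub e f) s = nval e s - nval f s"

primrec rval :: "rexp \<Rightarrow> state \<Rightarrow> real" where
  "rval (RVar x) s = rvar s x"
| "rval (RArr a e) s = rarr s a (nval e s)"
| "rval (RAdd e f) s = rval e s + rval f s"
| "rval (RSub e f) s = rval e s - rval f s"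

primrec bval :: "bexp \<Rightarrow> state \<Rightarrow> bool" where
  "bval (NLess e f) s \<longleftrightarrow> nval e s < nval f s"
| "bval (RLess e f) s \<longleftrightarrow> rval e s < rval f s"
| "bval (BNot b) s \<longleftrightarrow> \<not> bval b s"
| "bval (BAnd b c) s \<longleftrightarrow> bval b s \<and> bval c s"

primrec ncost :: "nexp \<Rightarrow> nat" where
  "ncost (NConst m) = 1"
| "ncost (NVar x) = 1"
| "ncost (NArr a e) = 1 + ncost e"
| "ncost (NAdd e f) = 1 + ncost e + ncost f"
| "ncost (NSub e f) = 1 + ncost e + ncost f"

primrec rcost :: "rexp \<Rightarrow> nat" where
  "rcost (RVar x) = 1"
| "rcost (RArr a e) = 1 + ncost e"
| "rcost (RAdd e f) = 1 + rcost e + rcost f"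
| "rcost (RSub e f) = 1 + rcost e + rcost f"

primrec bcost :: "bexp \<Rightarrow> nat" where
  "bcost (NLess e f) = 1 + ncost e + ncost f"
| "bcost (RLess e f) = 1 + rcost e + rcost f"
| "bcost (BNot b) = 1 + bcost b"
| "bcost (BAnd b c) = 1 + bcost b + bcost c"

text \<open>
  \<open>exec c s t s'\<close>: started in state \<open>s\<close>, the program \<open>c\<close> halts in state \<open>s'\<close> after exactly \<open>t\<close> steps.
\<close>

inductive exec :: "com \<Rightarrow> state \<Rightarrow> nat \<Rightarrow> state \<Rightarrow> bool" where
  Skip: "exec Skip s 1 s"
| NAssign: "exec (NAssign x e) s (1 + ncost e) (s\<lparr>nvar := (nvar s)(x := nval e s)\<rparr>)"
| NStore: "exec (NStore a i e) s (1 + ncost i + ncost e)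
    (s\<lparr>narr := (narr s)(a := (narr s a)(nval i s := nval e s))\<rparr>)"
| RAssign: "exec (RAssign x e) s (1 + rcost e) (s\<lparr>rvar := (rvar s)(x := rval e s)\<rparr>)"
| RStore: "exec (RStore a i e) s (1 + ncost i + rcost e)
    (s\<lparr>rarr := (rarr s)(a := (rarr s a)(nval i s := rval e s))\<rparr>)"
| Seq: "exec c s t s' \<Longrightarrow> exec c' s' t' s'' \<Longrightarrow> exec (Seq c c') s (1 + t + t') s''"
| CondTrue: "bval b s \<Longrightarrow> exec c s t s' \<Longrightarrow> exec (Cond b c c') s (1 + bcost b + t) s'"
| CondFalse: "\<not> bval b s \<Longrightarrow> exec c' s t s' \<Longrightarrow> exec (Cond b c c') s (1 + bcost b + t) s'"
| WhileFalse: "\<not> bval b s \<Longrightarrow> exec (While b c) s (1 + bcost b) s"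
| WhileTrue: "bval b s \<Longrightarrow> exec c s t s' \<Longrightarrow> exec (While b c) s' t' s'' \<Longrightarrow>
    exec (While b c) s (1 + bcost b + t + t') s''"

lemma exec_deterministic:
  "exec c s t s' \<Longrightarrow> exec c s u r \<Longrightarrow> u = t \<and> r = s'"
proof (induction arbitrary: u r rule: exec.induct)
  case (Seq c s t s' c' t' s'')
  from Seq.prems show ?case by cases (use Seq.IH in blast)
next
  case (CondTrue b s c t s' c')
  from CondTrue.prems show ?case by cases (use CondTrue in blast)+
next
  case (CondFalse b s c' t s' c)
  from CondFalse.prems show ?case by cases (use CondFalse in blast)+
next
  case (WhileFalse b s c)
  from WhileFalse.prems show ?case by cases (use WhileFalse in auto)
next
  case (WhileTrue b s c t s' t' s'')
  from WhileTrue.prems show ?case by cases (use WhileTrue in blast)+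
qed (erule exec.cases; simp)+


section \<open>Input and output conventions\<close>

text \<open>
  The input consists of the number \<open>n\<close> of points, the number \<open>k\<close> of clusters, and the \<open>n \<times> n\<close> distance
  matrix \<open>D\<close> in row-major order. All other cells are initially zero.
\<close>

definition msd_input :: "nat \<Rightarrow> nat \<Rightarrow> (nat \<Rightarrow> nat \<Rightarrow> real) \<Rightarrow> state" where
  "msd_input n k D =
     \<lparr>nvar = (\<lambda>_. 0)(''n'' := n, ''k'' := k),
      narr = (\<lambda>_ _. 0),
      rvar = (\<lambda>_. 0),
      rarr = (\<lambda>_ _. 0)(''dist'' := (\<lambda>m. if m < n * n then D (m div n) (m mod n) else 0))\<rparr>"

text \<open>
  The output is a label for each point; points with the same label form a cluster. Point number
  \<open>i < n\<close> stands for the element \<open>p i\<close> of the metric space.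
\<close>

definition msd_output :: "(nat \<Rightarrow> 'a) \<Rightarrow> nat \<Rightarrow> state \<Rightarrow> 'a set set" where
  "msd_output p n s = {{p j | j. j < n \<and> narr s ''label'' j = narr s ''label'' i} | i. i < n}"

end

theory Submission
  imports Defs
begin

text \<open>
  Take an optimal clustering \<open>P\<close> with as few clusters as possible. Merging a subfamily \<open>S\<close> of at least
  two clusters must strictly increase the cost, so \<open>\<Union>S\<close> has diameter larger than the sum of the
  diameters in \<open>S\<close>. Seen from an endpoint \<open>x\<close> of a diameter of \<open>\<Union>S\<close>, every cluster occupies a range
  of distances no longer than its own diameter, and these ranges are too short to cover everything
  up to the diameter of \<open>\<Union>S\<close>. They leave a gap, so some ball around \<open>x\<close>, whose radius is again a
  distance \<open>d x w\<close>, separates \<open>S\<close> into two nonempty subfamilies without cutting a cluster.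
  Hence \<open>P\<close> arises from the one-cluster partition by at most \<open>k - 1\<close> ball splits, each described by two
  points \<open>(u, w)\<close>, and trying all \<open>n ^ (2 * (k - 1))\<close> sequences of splits finds an optimum. A sequence is
  coded by the base-\<open>n\<close> digits of a number, extracted by repeated subtraction.
\<close>

section \<open>Separating optimal clusters by balls\<close>

lemma finite_distances: "finite C \<Longrightarrow> finite {d x y | x y. x \<in> C \<and> y \<in> C}"
  by (rule finite_image_set2) simp_all

lemma diam_ge: "finite C \<Longrightarrow> x \<in> C \<Longrightarrow> y \<in> C \<Longrightarrow> d x y \<le> diam d C"
  unfolding diam_def by (rule Max_ge[OF finite_distances]) auto

lemma diam_attained:
  assumes "finite C" "C \<noteq> {}"
  obtains x y where "x \<in> C" "y \<in> C" "diam d C = d x y"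
proof -
  have "diam d C \<in> {d x y | x y. x \<in> C \<and> y \<in> C}"
    unfolding diam_def by (rule Max_in[OF finite_distances]) (use assms in auto)
  with that show ?thesis by blast
qed

text \<open>Clusters are disjoint, so the nonempty set \<open>\<Union>S\<close> is disjoint from
  every cluster outside \<open>S\<close> and is not one of them: the merge trades at least two
  clusters for exactly one. The last conclusion lets the cost of the new clustering be computed with
  \<open>sum.insert\<close>.\<close>

lemma merge_clustering:
  assumes "clustering X k P" "finite P" "S \<subseteq> P" "2 \<le> card S"
  shows "clustering X k (insert (\<Union>S) (P - S))" "card (insert (\<Union>S) (P - S)) < card P"
    and "\<Union>S \<notin> P - S"
proof -
  have P: "partition_on X P" "card P \<le> k"
    using assms(1) by (auto simp: clustering_def)
  have "S \<noteq> {}" using assms(4) by auto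
  have ne: "{} \<notin> P" using partition_onD3[OF P(1)] .
  have disj: "disjnt C C'" if "C \<in> P" "C' \<in> P" "C \<noteq> C'" for C C'
    using P(1) that by (auto simp: partition_on_def pairwise_def)
  have "\<Union>S \<noteq> {}" using \<open>S \<noteq> {}\<close> ne assms(3) by (metis Union_empty_conv all_not_in_conv subsetD)
  have sep: "disjnt (\<Union>S) C" if "C \<in> P - S" for C
    unfolding disjnt_Union1 using that disj assms(3) by (metis DiffE subsetD)
  show notin: "\<Union>S \<notin> P - S"
    using sep \<open>\<Union>S \<noteq> {}\<close> by (auto simp: disjnt_def)
  have "partition_on X (insert (\<Union>S) (P - S))"
  proof (rule partition_onI)
    show "\<Union>(insert (\<Union>S) (P - S)) = X"
      using partition_onD1[OF P(1)] assms(3) by blast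
    show "{} \<notin> insert (\<Union>S) (P - S)"
      using ne \<open>\<Union>S \<noteq> {}\<close> by auto
    show "\<And>p q. p \<in> insert (\<Union>S) (P - S) \<Longrightarrow> q \<in> insert (\<Union>S) (P - S) \<Longrightarrow> p \<noteq> q \<Longrightarrow> disjnt p q"
      using sep disj by (metis DiffD1 disjnt_sym insertE)
  qed
  moreover have "card (insert (\<Union>S) (P - S)) = Suc (card P - card S)"
    using assms notin by (simp add: card_Diff_subset finite_subset)
  moreover have "card S \<le> card P"
    using assms by (simp add: card_mono)
  ultimately show "clustering X k (insert (\<Union>S) (P - S))"
    and "card (insert (\<Union>S) (P - S)) < card P"
    using assms(4) P(2) by (auto simp: clustering_def)
qed

text \<open>Ties between optima are broken by the number of clusters. If merging \<open>S\<close>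
  did not raise the cost, the merged clustering would be optimal too, with fewer clusters. This
  gives the strict inequality on which the separation by balls rests.\<close>

lemma minimal_optimal_clustering:
  assumes "finite X" "X \<noteq> {}" "k \<ge> 1"
  obtains P where "msd_optimal X d k P"
    and "\<And>S. S \<subseteq> P \<Longrightarrow> 2 \<le> card S \<Longrightarrow> (\<Sum>C\<in>S. diam d C) < diam d (\<Union>S)"
proof -
  let ?F = "{P. clustering X k P}"
  have "?F \<subseteq> Pow (Pow X)"
    by (auto simp: clustering_def partition_on_def)
  then have "finite ?F"
    using assms(1) by (meson finite_Pow_iff finite_subset)
  \<comment> \<open>The one-cluster partition is a candidate to minimise over; here
    \<open>k \<ge> 1\<close> and \<open>X \<noteq> {}\<close> enter.\<close>
  moreover have "{X} \<in> ?F"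
    using assms by (auto simp: clustering_def partition_on_space)
  ultimately have "msd_optimal X d k (arg_min_on (sum_diam d) ?F)"
    using arg_min_if_finite(1)[of ?F "sum_diam d"] arg_min_least[of ?F _ "sum_diam d"]
    unfolding msd_optimal_def by blast
  from ex_has_least_nat[of "msd_optimal X d k", OF this, of card]
  obtain P where P: "msd_optimal X d k P"
    and least: "\<And>Q. msd_optimal X d k Q \<Longrightarrow> card P \<le> card Q"
    by blast
  have cl: "clustering X k P"
    using P by (simp add: msd_optimal_def)
  then have "finite P"
    using \<open>?F \<subseteq> Pow (Pow X)\<close> assms(1) by (meson Pow_iff finite_Pow_iff finite_subset mem_Collect_eq subsetD)
  have "(\<Sum>C\<in>S. diam d C) < diam d (\<Union>S)" if S: "S \<subseteq> P" "2 \<le> card S" for S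
  proof (rule ccontr)
    assume small: "\<not> ?thesis"
    note m = merge_clustering[OF cl \<open>finite P\<close> S]
    have "sum_diam d (insert (\<Union>S) (P - S)) = diam d (\<Union>S) + (\<Sum>C\<in>P - S. diam d C)"
      unfolding sum_diam_def using m(3) \<open>finite P\<close> by (intro sum.insert) auto
    also have "\<dots> \<le> (\<Sum>C\<in>S. diam d C) + (\<Sum>C\<in>P - S. diam d C)"
      using small by simp
    also have "\<dots> = sum_diam d P"
      unfolding sum_diam_def using sum.subset_diff[OF S(1) \<open>finite P\<close>, of "diam d"] by simp
    finally have "msd_optimal X d k (insert (\<Union>S) (P - S))"
      using P m(1) unfolding msd_optimal_def by fastforce
    with least m(2) show False by fastforce
  qed
  with P that show ?thesis by blast
qed

text \<open>
  Grow a subfamily \<open>T\<close> around \<open>x\<close> as long as \<open>\<Union>T\<close> stays within distance \<open>\<Sum>C\<in>T. diam d C\<close> of \<open>x\<close>.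
  When it cannot be enlarged, no other cluster meets the smallest ball around \<open>x\<close> containing \<open>\<Union>T\<close>,
  since such a cluster could be added to \<open>T\<close>.
\<close>
lemma ball_separates_clusters:
  assumes "Metric_space X d" "finite X" "\<Union>S \<subseteq> X" "S \<noteq> {}" "{} \<notin> S"
    and large: "(\<Sum>C\<in>S. diam d C) < diam d (\<Union>S)"
  obtains T x w where "T \<subset> S" "T \<noteq> {}" "x \<in> \<Union>T" "w \<in> \<Union>T"
    and "\<And>z. z \<in> \<Union>T \<Longrightarrow> d x z \<le> d x w" "\<And>z. z \<in> \<Union>(S - T) \<Longrightarrow> d x w < d x z"
proof -
  interpret Metric_space X d by fact
  have fin: "finite (\<Union>S)" "finite S"
    using assms(2,3) by (auto intro: finite_subset finite_UnionD)
  have finC: "finite C" if "C \<in> S" for C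
    using that fin(1) by (meson Union_upper finite_subset)
  obtain x y where xy: "x \<in> \<Union>S" "y \<in> \<Union>S" "diam d (\<Union>S) = d x y"
    using diam_attained[OF fin(1), of d] assms(4,5) by (metis Union_empty_conv subsetI subset_singletonD insertI1)
  then obtain C0 where C0: "C0 \<in> S" "x \<in> C0" by blast
  define near where "near T \<longleftrightarrow> T \<subseteq> S \<and> C0 \<in> T \<and> (\<forall>z\<in>\<Union>T. d x z \<le> (\<Sum>C\<in>T. diam d C))" for T
  \<comment> \<open>The growth starts at the cluster of \<open>x\<close>, whose points lie within
    its own diameter of \<open>x\<close>.\<close>
  have "near {C0}"
    using C0 finC by (auto simp: near_def diam_ge)
  moreover have "finite {T. near T}"
    using fin(2) by (rule_tac finite_subset[of _ "Pow S"]) (auto simp: near_def)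
  ultimately obtain T where T: "near T" and maximal: "\<And>T'. near T' \<Longrightarrow> T \<subseteq> T' \<Longrightarrow> T = T'"
    using finite_has_maximal[of "{T. near T}"] by blast
  have "T \<subseteq> S" "C0 \<in> T" using T by (auto simp: near_def)
  have "T \<noteq> S"
  proof
    assume "T = S"
    with T xy(2) have "d x y \<le> (\<Sum>C\<in>S. diam d C)" by (auto simp: near_def)
    with large xy(3) show False by simp
  qed
  have "x \<in> \<Union>T" using C0 \<open>C0 \<in> T\<close> by blast
  have "finite (\<Union>T)" using \<open>T \<subseteq> S\<close> fin(1) by (meson Union_mono finite_subset)
  obtain w where w: "w \<in> \<Union>T" "\<And>z. z \<in> \<Union>T \<Longrightarrow> d x z \<le> d x w"
  proof -
    have "Max (d x ` \<Union>T) \<in> d x ` \<Union>T"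
      using \<open>finite (\<Union>T)\<close> \<open>x \<in> \<Union>T\<close> by (intro Max_in) auto
    then obtain w where "w \<in> \<Union>T" "Max (d x ` \<Union>T) = d x w" by (rule imageE)
    then show ?thesis
      using that Max_ge[OF finite_imageI[OF \<open>finite (\<Union>T)\<close>] imageI, of _ "d x"] by metis
  qed
  have "d x w < d x z" if z: "z \<in> \<Union>(S - T)" for z
  proof (rule ccontr)
    assume close: "\<not> ?thesis"
    obtain C where C: "C \<in> S" "C \<notin> T" "z \<in> C" using z by blast
    have Tw: "d x w \<le> (\<Sum>C\<in>T. diam d C)" using T w(1) by (auto simp: near_def)
    have sum: "(\<Sum>C\<in>insert C T. diam d C) = diam d C + (\<Sum>C\<in>T. diam d C)"
      using C(2) \<open>T \<subseteq> S\<close> fin(2) by (simp add: finite_subset)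
    \<comment> \<open>A point of \<open>C\<close> is reached from \<open>x\<close> through
      \<open>z\<close>: the first leg is at most \<open>d x w\<close>, already paid for by the
      diameters in \<open>T\<close>, and the second at most \<open>diam d C\<close>.\<close>
    have "d x z' \<le> diam d C + (\<Sum>C\<in>T. diam d C)" if "z' \<in> C" for z'
    proof -
      have "d x z' \<le> d x z + d z z'"
        using xy(1) C that assms(3) by (intro triangle) auto
      also have "\<dots> \<le> (\<Sum>C\<in>T. diam d C) + diam d C"
        using close Tw diam_ge[OF finC[OF C(1)] C(3) that, of d] by linarith
      finally show ?thesis by simp
    qed
    moreover have "d x z' \<le> diam d C + (\<Sum>C\<in>T. diam d C)" if "z' \<in> \<Union>T" for z'
    proof -
      have "0 \<le> diam d C"
        using diam_ge[OF finC[OF C(1)] C(3) C(3), of d] nonneg[of z z] by linarith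
      moreover have "d x z' \<le> (\<Sum>C\<in>T. diam d C)"
        using that T unfolding near_def by blast
      ultimately show ?thesis by linarith
    qed
    ultimately have "near (insert C T)"
      using C(1) \<open>T \<subseteq> S\<close> \<open>C0 \<in> T\<close> unfolding near_def sum by blast
    with maximal C(2) show False by blast
  qed
  with that[of T x w] \<open>T \<subseteq> S\<close> \<open>T \<noteq> S\<close> \<open>C0 \<in> T\<close> \<open>x \<in> \<Union>T\<close> w show ?thesis by blast
qed

section \<open>Labellings obtained by ball splits\<close>

text \<open>Giving the radius by a point \<open>w\<close> keeps the description of a split finite.
  The ball is closed, so \<open>w\<close> itself stays inside; in a metric the centre
  \<open>u\<close> always keeps its label.\<close>

definition split_at :: "(nat \<Rightarrow> nat \<Rightarrow> real) \<Rightarrow> nat \<Rightarrow> nat \<Rightarrow> nat \<Rightarrow> (nat \<Rightarrow> nat) \<Rightarrow> nat \<Rightarrow> nat" where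
  "split_at D u w t f = (\<lambda>i. if f i = f u \<and> D u w < D u i then t else f i)"

primrec labels :: "(nat \<Rightarrow> nat \<Rightarrow> real) \<Rightarrow> (nat \<Rightarrow> nat) \<Rightarrow> nat \<Rightarrow> nat \<Rightarrow> nat" where
  "labels D e 0 = (\<lambda>_. 0)"
| "labels D e (Suc t) = split_at D (e (2 * t)) (e (2 * t + 1)) (Suc t) (labels D e t)"

text \<open>This makes \<open>Suc t\<close> a fresh label for the next split, and for
  \<open>t = k - 1\<close> with \<open>k > 0\<close> it keeps all labels below
  \<open>k\<close>.\<close>

lemma labels_le: "labels D e t i \<le> t"
  by (induction t arbitrary: i) (auto simp: split_at_def intro: le_SucI)

text \<open>Allows a sequence of split points to be replaced by the digits of a number, and later
  entries to be changed without disturbing earlier splits.\<close>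

lemma labels_cong: "(\<And>j. j < 2 * t \<Longrightarrow> e j = e' j) \<Longrightarrow> labels D e t = labels D e' t"
  by (induction t) auto

text \<open>Least significant digit first, the order in which repeated division by \<open>n\<close>
  delivers them.\<close>

definition digit :: "nat \<Rightarrow> nat \<Rightarrow> nat \<Rightarrow> nat" where
  "digit n x j = x div n ^ j mod n"

text \<open>Horner's scheme: the induction removes the lowest digit and codes the remaining ones by
  a number below the next smaller power of \<open>n\<close>.\<close>

lemma ex_digits:
  assumes "0 < n" "\<And>j. j < m \<Longrightarrow> e j < n"
  shows "\<exists>x < n ^ m. \<forall>j<m. digit n x j = e j"
  using assms(2)
proof (induction m arbitrary: e)
  case 0
  then show ?case by simp
next
  case (Suc m)
  obtain x where x: "x < n ^ m" "\<And>j. j < m \<Longrightarrow> digit n x j = e (Suc j)"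
    using Suc.IH[of "\<lambda>j. e (Suc j)"] Suc.prems by auto
  let ?y = "e 0 + n * x"
  have "e 0 < n" using Suc.prems by simp
  then have "?y < n * Suc x" by simp
  also have "\<dots> \<le> n * n ^ m" using x(1) by (intro mult_le_mono2) simp
  finally have "?y < n ^ Suc m" by simp
  moreover have "digit n ?y j = e j" if "j < Suc m" for j
    using that x(2) \<open>e 0 < n\<close> \<open>0 < n\<close>
    by (cases j) (simp_all add: digit_def div_mult2_eq)
  ultimately show ?case by blast
qed

section \<open>Clusterings read off from labellings, and their cost\<close>

definition classes :: "(nat \<Rightarrow> 'a) \<Rightarrow> nat \<Rightarrow> (nat \<Rightarrow> nat) \<Rightarrow> 'a set set" where
  "classes p n f = {{p j | j. j < n \<and> f j = f i} | i. i < n}"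

lemma msd_output_classes: "msd_output p n s = classes p n (narr s ''label'')"
  by (simp add: msd_output_def classes_def)

text \<open>Indexing by attained labels instead of points is the form used for counting classes and
  for summing over them.\<close>

lemma classes_image: "classes p n f = (\<lambda>t. {p j | j. j < n \<and> f j = t}) ` f ` {..<n}"
  by (auto simp: classes_def)

lemma classes_cong:
  assumes "\<And>i. i < n \<Longrightarrow> f i = g i"
  shows "classes p n f = classes p n g"
proof -
  have "{p j | j. j < n \<and> f j = t} = {p j | j. j < n \<and> g j = t}" for t
    by (simp add: assms cong: conj_cong)
  moreover have "f ` {..<n} = g ` {..<n}"
    using assms by (intro image_cong) auto
  ultimately show ?thesis
    by (simp only: classes_image)
qed

text \<open>The inserted \<open>0\<close> makes unused labels contribute nothing to the cost.\<close>
definition class_diam :: "(nat \<Rightarrow> nat \<Rightarrow> real) \<Rightarrow> nat \<Rightarrow> (nat \<Rightarrow> nat) \<Rightarrow> nat \<Rightarrow> real" where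
  "class_diam D n f t =
     Max (insert 0 ((\<lambda>(i, j). D i j) ` {(i, j). i < n \<and> j < n \<and> f i = t \<and> f j = t}))"

lemma clustering_classes:
  assumes "bij_betw p {..<n} X" "\<And>i. i < n \<Longrightarrow> f i < k"
  shows "clustering X k (classes p n f)"
proof -
  have X: "X = p ` {..<n}" and inj: "inj_on p {..<n}"
    using assms(1) by (auto simp: bij_betw_def)
  have "partition_on X (classes p n f)"
  proof (rule partition_onI)
    show "\<Union>(classes p n f) = X" by (auto simp: classes_def X)
    show "{} \<notin> classes p n f" by (auto simp: classes_def)
    show "disjnt A B" if AB: "A \<in> classes p n f" "B \<in> classes p n f" "A \<noteq> B" for A B
    proof -
      obtain a b where ab: "A = {p j | j. j < n \<and> f j = a}" "B = {p j | j. j < n \<and> f j = b}"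
        using AB(1,2) by (auto simp: classes_def)
      have False if x: "x \<in> A" "x \<in> B" for x
      proof -
        obtain i j where "i < n" "f i = a" "j < n" "f j = b" "p i = p j"
          using x unfolding ab by blast
        then have "a = b" using inj by (metis inj_onD lessThan_iff)
        with AB(3) ab show False by simp
      qed
      then show ?thesis by (auto simp: disjnt_iff)
    qed
  qed
  moreover have "card (classes p n f) \<le> card (f ` {..<n})"
    unfolding classes_image by (rule card_image_le) simp
  moreover have "card (f ` {..<n}) \<le> card {..<k}"
    by (rule card_mono) (use assms(2) in auto)
  ultimately show ?thesis by (simp add: clustering_def)
qed

text \<open>The program sums over all labels below \<open>k\<close>, the cost over distinct classes.
  Distinct attained labels have distinct nonempty classes, whose diameters are nonnegative and so
  absorb the inserted \<open>0\<close>; unattained labels contribute \<open>0\<close>.\<close>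

lemma sum_diam_classes:
  assumes "inj_on p {..<n}" "\<And>x y. 0 \<le> d x y" "\<And>i. i < n \<Longrightarrow> f i < k"
  shows "sum_diam d (classes p n f) = (\<Sum>t<k. class_diam (\<lambda>i j. d (p i) (p j)) n f t)"
proof -
  let ?c = "\<lambda>t. {p j | j. j < n \<and> f j = t}"
  have "inj_on ?c (f ` {..<n})"
  proof (rule inj_onI)
    fix a b assume "a \<in> f ` {..<n}" and eq: "?c a = ?c b"
    then obtain i where i: "i < n" "a = f i" by auto
    then have "p i \<in> ?c b" using eq by blast
    then obtain j where "p i = p j" "j < n" "f j = b" by blast
    with i assms(1) show "a = b" by (auto simp: inj_on_def)
  qed
  then have "sum_diam d (classes p n f) = (\<Sum>t\<in>f ` {..<n}. diam d (?c t))"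
    unfolding sum_diam_def classes_image by (simp add: sum.reindex)
  also have "\<dots> = (\<Sum>t\<in>f ` {..<n}. class_diam (\<lambda>i j. d (p i) (p j)) n f t)"
  proof (rule sum.cong[OF refl])
    fix t assume "t \<in> f ` {..<n}"
    then obtain i where i: "i < n" "f i = t" by auto
    let ?I = "(\<lambda>(i, j). d (p i) (p j)) ` {(i, j). i < n \<and> j < n \<and> f i = t \<and> f j = t}"
    have eq: "{d x y | x y. x \<in> ?c t \<and> y \<in> ?c t} = ?I"
      by (auto simp: image_iff)
    have "finite ?I"
      by (rule finite_imageI, rule finite_subset[of _ "{..<n} \<times> {..<n}"]) auto
    moreover have "?I \<noteq> {}" using i by auto
    ultimately have "Max (insert 0 ?I) = max 0 (Max ?I)" by (rule Max_insert)
    moreover have "0 \<le> Max ?I"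
      using Max_in[OF \<open>finite ?I\<close> \<open>?I \<noteq> {}\<close>] assms(2) by auto
    ultimately show "diam d (?c t) = class_diam (\<lambda>i j. d (p i) (p j)) n f t"
      unfolding diam_def class_diam_def eq by simp
  qed
  also have "\<dots> = (\<Sum>t<k. class_diam (\<lambda>i j. d (p i) (p j)) n f t)"
  proof (rule sum.mono_neutral_left)
    show "\<forall>t\<in>{..<k} - f ` {..<n}. class_diam (\<lambda>i j. d (p i) (p j)) n f t = 0"
    proof
      fix t assume "t \<in> {..<k} - f ` {..<n}"
      then have "{(i, j). i < n \<and> j < n \<and> f i = t \<and> f j = t} = {}" by auto
      then show "class_diam (\<lambda>i j. d (p i) (p j)) n f t = 0"
        by (simp only: class_diam_def image_empty Max_singleton)
    qed
  qed (use assms(3) in auto)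
  finally show ?thesis .
qed

section \<open>Splitting down to a given partition\<close>

definition coarsens :: "(nat \<Rightarrow> 'a) \<Rightarrow> nat \<Rightarrow> (nat \<Rightarrow> nat) \<Rightarrow> 'a set set \<Rightarrow> bool" where
  "coarsens p n f P \<longleftrightarrow> (\<forall>C\<in>P. \<forall>i<n. \<forall>j<n. p i \<in> C \<longrightarrow> p j \<in> C \<longrightarrow> f i = f j)"

lemma coarsensD: "coarsens p n f P \<Longrightarrow> C \<in> P \<Longrightarrow> i < n \<Longrightarrow> j < n \<Longrightarrow> p i \<in> C \<Longrightarrow> p j \<in> C \<Longrightarrow> f i = f j"
  unfolding coarsens_def by blast

text \<open>A labelling that cuts no cluster descends to a map \<open>g\<close> on clusters, so that
  counting labels becomes counting the image of \<open>P\<close>.\<close>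

lemma coarsens_label_map:
  assumes "bij_betw p {..<n} X" "partition_on X P" "coarsens p n f P"
  obtains g where "g ` P = f ` {..<n}" "\<And>C i. C \<in> P \<Longrightarrow> i < n \<Longrightarrow> p i \<in> C \<Longrightarrow> g C = f i"
proof -
  have X: "X = p ` {..<n}" using assms(1) by (simp add: bij_betw_def)
  have UP: "\<Union>P = X" and ne: "{} \<notin> P" using assms(2) by (auto simp: partition_on_def)
  define g where "g C = f (SOME i. i < n \<and> p i \<in> C)" for C
  have g: "g C = f i" if "C \<in> P" "i < n" "p i \<in> C" for C i
  proof -
    have "(SOME i. i < n \<and> p i \<in> C) < n \<and> p (SOME i. i < n \<and> p i \<in> C) \<in> C"
      using someI[of "\<lambda>i. i < n \<and> p i \<in> C" i] that by blast
    then show ?thesis unfolding g_def using coarsensD[OF assms(3) that(1)] that by blast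
  qed
  moreover have "g ` P = f ` {..<n}"
  proof
    show "g ` P \<subseteq> f ` {..<n}"
    proof
      fix t assume "t \<in> g ` P"
      then obtain C where C: "C \<in> P" "t = g C" by blast
      then obtain y where "y \<in> C" using ne by (metis ex_in_conv)
      then obtain i where "i < n" "y = p i" using C(1) UP X by blast
      with g C \<open>y \<in> C\<close> show "t \<in> f ` {..<n}" by blast
    qed
    show "f ` {..<n} \<subseteq> g ` P"
    proof
      fix t assume "t \<in> f ` {..<n}"
      then obtain i where i: "i < n" "t = f i" by blast
      then obtain C where "C \<in> P" "p i \<in> C" using UP X by blast
      with g i show "t \<in> g ` P" by (metis imageI)
    qed
  qed
  ultimately show ?thesis using that by blast
qed

text \<open>The map \<open>g\<close> from clusters to labels is onto. With at least as many labels
  as clusters it is injective, so points with equal labels lie in the same cluster.\<close>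

lemma classes_eq_partition:
  assumes "bij_betw p {..<n} X" "partition_on X P" "finite P" "coarsens p n f P"
    and "card P \<le> card (f ` {..<n})"
  shows "classes p n f = P"
proof -
  have X: "X = p ` {..<n}" using assms(1) by (simp add: bij_betw_def)
  have UP: "\<Union>P = X" and ne: "{} \<notin> P" using assms(2) by (auto simp: partition_on_def)
  obtain g where g: "g ` P = f ` {..<n}" "\<And>C i. C \<in> P \<Longrightarrow> i < n \<Longrightarrow> p i \<in> C \<Longrightarrow> g C = f i"
    using coarsens_label_map[OF assms(1,2,4)] by blast
  have "card (g ` P) = card P"
    using assms(5) g(1) card_image_le[OF assms(3), of g] by simp
  then have inj: "inj_on g P" by (rule eq_card_imp_inj_on[OF assms(3)])
  have cls: "{p j | j. j < n \<and> f j = f i} = C" if i: "C \<in> P" "i < n" "p i \<in> C" for C i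
  proof
    show "{p j | j. j < n \<and> f j = f i} \<subseteq> C"
    proof
      fix y assume "y \<in> {p j | j. j < n \<and> f j = f i}"
      then obtain j where j: "y = p j" "j < n" "f j = f i" by blast
      then obtain C' where C': "C' \<in> P" "p j \<in> C'" using UP X by blast
      then have "g C' = g C" using g(2) i j by metis
      then have "C' = C" using inj C'(1) i(1) by (meson inj_onD)
      with C' j show "y \<in> C" by simp
    qed
    show "C \<subseteq> {p j | j. j < n \<and> f j = f i}"
    proof
      fix y assume "y \<in> C"
      moreover from this obtain j where "j < n" "y = p j" using UP X i(1) by blast
      ultimately show "y \<in> {p j | j. j < n \<and> f j = f i}"
        using coarsensD[OF assms(4) i(1) _ i(2) _ i(3)] by blast
    qed
  qed
  show ?thesis
  proof
    show "classes p n f \<subseteq> P"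
    proof
      fix A assume "A \<in> classes p n f"
      then obtain i where i: "i < n" "A = {p j | j. j < n \<and> f j = f i}"
        by (auto simp: classes_def)
      then obtain C where "C \<in> P" "p i \<in> C" using UP X by blast
      with cls i show "A \<in> P" by simp
    qed
    show "P \<subseteq> classes p n f"
    proof
      fix C assume C: "C \<in> P"
      then obtain y where "y \<in> C" using ne by (metis ex_in_conv)
      then have "y \<in> p ` {..<n}" using UP X C by blast
      then obtain i where i: "i < n" "p i \<in> C" using \<open>y \<in> C\<close> by auto
      have "{p j | j. j < n \<and> f j = f i} \<in> classes p n f"
        unfolding classes_def by (intro CollectI exI[of _ i] conjI refl i(1))
      then show "C \<in> classes p n f" by (simp only: cls[OF C i])
    qed
  qed
qed

text \<open>Each split either gains a new label without losing an old one, or comes when there are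
  already as many labels as clusters; \<open>min (Suc t) (card P)\<close> covers both situations. No
  split cuts a cluster of \<open>P\<close>.\<close>

lemma labels_reach_partition:
  assumes "Metric_space X d" "bij_betw p {..<n} X" "0 < n" "partition_on X P"
    and merge: "\<And>S. S \<subseteq> P \<Longrightarrow> 2 \<le> card S \<Longrightarrow> (\<Sum>C\<in>S. diam d C) < diam d (\<Union>S)"
  shows "\<exists>e. (\<forall>j. e j < n) \<and> coarsens p n (labels (\<lambda>i j. d (p i) (p j)) e t) P \<and>
    min (Suc t) (card P) \<le> card (labels (\<lambda>i j. d (p i) (p j)) e t ` {..<n})"
proof (induction t)
  case 0
  have "(\<lambda>_. 0::nat) ` {..<n} = {0}" using \<open>0 < n\<close> by auto
  then show ?case using \<open>0 < n\<close> by (intro exI[of _ "\<lambda>_. 0"]) (simp add: coarsens_def)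
next
  case (Suc t)
  let ?D = "\<lambda>i j. d (p i) (p j)"
  obtain e where e: "\<And>j. e j < n" and co': "coarsens p n (labels ?D e t) P"
    and card: "min (Suc t) (card P) \<le> card (labels ?D e t ` {..<n})"
    using Suc.IH by blast
  define f where "f = labels ?D e t"
  have co: "coarsens p n f P" using co' by (simp add: f_def)
  have X: "X = p ` {..<n}" using assms(2) by (simp add: bij_betw_def)
  have UP: "\<Union>P = X" and ne: "{} \<notin> P" using assms(4) by (auto simp: partition_on_def)
  have "finite X" by (simp add: X)
  have "finite P"
    using UP \<open>finite X\<close> by (simp add: finite_UnionD)
  have "\<exists>u<n. \<exists>w<n. coarsens p n (split_at ?D u w (Suc t) f) P \<and>
    min (Suc (Suc t)) (card P) \<le> card (split_at ?D u w (Suc t) f ` {..<n})"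
  proof (cases "card P \<le> card (f ` {..<n})")
    case True
    \<comment> \<open>There are enough labels, so the remaining splits must have no effect: with
      \<open>w\<close> farthest from point \<open>0\<close>, the ball contains every point.\<close>
    have fin: "finite (?D 0 ` {..<n})" by simp
    have "Max (?D 0 ` {..<n}) \<in> ?D 0 ` {..<n}"
      using \<open>0 < n\<close> by (intro Max_in[OF fin]) auto
    then obtain w where w: "w < n" "Max (?D 0 ` {..<n}) = ?D 0 w" by auto
    have "?D 0 i \<le> ?D 0 w" if "i < n" for i
      using Max_ge[OF fin, of "?D 0 i"] that w(2) by simp
    then have same: "split_at ?D 0 w (Suc t) f i = f i" if "i < n" for i
      using that by (force simp: split_at_def)
    then have "coarsens p n (split_at ?D 0 w (Suc t) f) P"
      using co unfolding coarsens_def by metis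
    moreover have "split_at ?D 0 w (Suc t) f ` {..<n} = f ` {..<n}"
      using same by (intro image_cong) auto
    ultimately show ?thesis
      using True w(1) \<open>0 < n\<close> by (metis min.coboundedI2)
  next
    case False
    obtain g where g: "g ` P = f ` {..<n}" "\<And>C i. C \<in> P \<Longrightarrow> i < n \<Longrightarrow> p i \<in> C \<Longrightarrow> g C = f i"
      using coarsens_label_map[OF assms(2,4) co] by blast
    \<comment> \<open>Fewer labels than clusters, so two clusters share one. Taking for
      \<open>S\<close> all clusters with that label ensures that the split touches no cluster
      outside \<open>S\<close>.\<close>
    have "\<not> inj_on g P"
      using False g(1) card_image[of g P] by auto
    then obtain C1 C2 where C12: "C1 \<in> P" "C2 \<in> P" "g C1 = g C2" "C1 \<noteq> C2"
      by (auto simp: inj_on_def)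
    define S where "S = {C \<in> P. g C = g C1}"
    have "S \<subseteq> P" "{C1, C2} \<subseteq> S" using C12 by (auto simp: S_def)
    then have "2 \<le> card S"
      using card_mono[of S "{C1, C2}"] C12(4) \<open>finite P\<close> by (simp add: finite_subset)
    have US: "\<Union>S \<subseteq> X" using \<open>S \<subseteq> P\<close> UP by blast
    have Sne: "S \<noteq> {}" "{} \<notin> S" using \<open>{C1, C2} \<subseteq> S\<close> \<open>S \<subseteq> P\<close> ne by auto
    obtain T x y where T: "T \<subset> S" "T \<noteq> {}" and x: "x \<in> \<Union>T" and y: "y \<in> \<Union>T"
      and inner: "\<And>z. z \<in> \<Union>T \<Longrightarrow> d x z \<le> d x y"
      and outer: "\<And>z. z \<in> \<Union>(S - T) \<Longrightarrow> d x y < d x z"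
      by (rule ball_separates_clusters[OF assms(1) \<open>finite X\<close> US Sne merge[OF \<open>S \<subseteq> P\<close> \<open>2 \<le> card S\<close>]])
        blast
    have index: "\<exists>i<n. z = p i" if "z \<in> \<Union>S" for z
      using that US X by blast
    obtain u where u: "u < n" "x = p u" using index x T(1) by blast
    obtain w where w: "w < n" "y = p w" using index y T(1) by blast
    have fS: "f i = g C1" if "C \<in> S" "i < n" "p i \<in> C" for C i
      using g(2)[of C i] that by (simp add: S_def)
    have fu: "f u = g C1" using fS x u T(1) by blast
    \<comment> \<open>\<open>f u\<close> is the shared label, so the split acts only on
      \<open>S\<close>; there the ball contains exactly the clusters in \<open>T\<close>.\<close>
    let ?f = "split_at ?D u w (Suc t) f"
    have new: "?f i = (if C \<in> S - T then Suc t else f i)" if "C \<in> P" "i < n" "p i \<in> C" for C i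
    proof (cases "C \<in> S")
      case True
      have "d x y < d x (p i) \<longleftrightarrow> C \<in> S - T"
      proof (cases "C \<in> T")
        case True
        then have "d x (p i) \<le> d x y" using inner that(3) by blast
        with True show ?thesis by simp
      next
        case False
        then have "d x y < d x (p i)" using outer that(3) \<open>C \<in> S\<close> by blast
        with False \<open>C \<in> S\<close> show ?thesis by simp
      qed
      then show ?thesis
        using fS[OF True that(2,3)] fu u(2) w(2) by (simp add: split_at_def)
    next
      case False
      then have "f i \<noteq> g C1" using g(2)[OF that] that(1) by (simp add: S_def)
      then show ?thesis using False fu by (simp add: split_at_def)
    qed
    have "coarsens p n ?f P"
      unfolding coarsens_def
    proof (intro ballI allI impI)
      fix C i j assume *: "C \<in> P" "i < n" "j < n" "p i \<in> C" "p j \<in> C"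
      show "?f i = ?f j"
        unfolding new[OF *(1,2,4)] new[OF *(1,3,5)] coarsensD[OF co *] ..
    qed
    have "insert (Suc t) (f ` {..<n}) \<subseteq> ?f ` {..<n}"
    proof (rule insert_subsetI)
      obtain C where C: "C \<in> S - T" using T(1) by blast
      then have "C \<in> P" "C \<noteq> {}" using \<open>S \<subseteq> P\<close> ne by auto
      then obtain i where "i < n" "p i \<in> C" using index C by blast
      with new[OF \<open>C \<in> P\<close>] C show "Suc t \<in> ?f ` {..<n}"
        by (metis imageI lessThan_iff)
      show "f ` {..<n} \<subseteq> ?f ` {..<n}"
      proof
        fix l assume "l \<in> f ` {..<n}"
        then obtain i where i: "i < n" "l = f i" by blast
        then obtain C where C: "C \<in> P" "p i \<in> C" using UP X by blast
        show "l \<in> ?f ` {..<n}"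
        proof (cases "C \<in> S - T")
          case True
          \<comment> \<open>The shared label is not lost, because \<open>u\<close> lies in its own
            ball and keeps it.\<close>
          then have "l = f u" using fS[OF _ i(1) C(2)] i fu by simp
          moreover have "?f u = f u"
            using inner[OF x] u(2) w(2) by (simp add: split_at_def)
          ultimately show ?thesis using u(1) by (metis imageI lessThan_iff)
        next
          case False
          have "?f i = (if C \<in> S - T then Suc t else f i)" by (rule new[OF C(1) i(1) C(2)])
          also have "\<dots> = l" using False i(2) by (simp only: if_False)
          finally show ?thesis using i(1) by blast
        qed
      qed
    qed
    then have "card (insert (Suc t) (f ` {..<n})) \<le> card (?f ` {..<n})"
      by (intro card_mono) simp_all
    moreover have "Suc t \<notin> f ` {..<n}"
    proof
      assume "Suc t \<in> f ` {..<n}"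
      then obtain i where "Suc t = f i" by blast
      moreover have "f i \<le> t" unfolding f_def by (rule labels_le)
      ultimately show False by simp
    qed
    ultimately have "Suc (card (f ` {..<n})) \<le> card (?f ` {..<n})"
      by simp
    with card have "min (Suc (Suc t)) (card P) \<le> card (?f ` {..<n})"
      unfolding f_def[symmetric] by linarith
    with \<open>coarsens p n ?f P\<close> u(1) w(1) show ?thesis by blast
  qed
  then obtain u w where uw: "u < n" "w < n" "coarsens p n (split_at ?D u w (Suc t) f) P"
    "min (Suc (Suc t)) (card P) \<le> card (split_at ?D u w (Suc t) f ` {..<n})" by blast
  let ?e = "e(2 * t := u, 2 * t + 1 := w)"
  have "labels ?D ?e t = f"
    unfolding f_def by (rule labels_cong) simp
  then have "labels ?D ?e (Suc t) = split_at ?D u w (Suc t) f" by simp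
  moreover have "\<forall>j. ?e j < n" using e uw(1,2) by simp
  ultimately show ?case using uw(3,4) by metis
qed

section \<open>Total correctness with time bounds\<close>

text \<open>By \<open>exec_deterministic\<close> the existential speaks about the only terminating
  run. Having the budget \<open>T\<close> as a parameter allows a postcondition to be another
  \<open>wp\<close> with a budget of its own, as in \<open>wp_Seq\<close>.\<close>

definition wp :: "com \<Rightarrow> (state \<Rightarrow> bool) \<Rightarrow> nat \<Rightarrow> state \<Rightarrow> bool" where
  "wp c Q T s \<longleftrightarrow> (\<exists>t s'. exec c s t s' \<and> t \<le> T \<and> Q s')"

lemma wpI: "exec c s t s' \<Longrightarrow> t \<le> T \<Longrightarrow> Q s' \<Longrightarrow> wp c Q T s"
  unfolding wp_def by blast

lemma wp_conseq:
  "wp c Q T s \<Longrightarrow> (\<And>s'. Q s' \<Longrightarrow> Q' s') \<Longrightarrow> T \<le> T' \<Longrightarrow> wp c Q' T' s"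
  unfolding wp_def by (meson order_trans)

lemma wp_Skip: "wp Skip Q T s \<longleftrightarrow> 1 \<le> T \<and> Q s"
  unfolding wp_def by (blast intro: exec.intros dest: exec_deterministic[OF exec.Skip])

lemma wp_NAssign:
  "wp (NAssign x e) Q T s \<longleftrightarrow> 1 + ncost e \<le> T \<and> Q (s\<lparr>nvar := (nvar s)(x := nval e s)\<rparr>)"
  unfolding wp_def by (blast intro: exec.intros dest: exec_deterministic[OF exec.NAssign])

lemma wp_NStore:
  "wp (NStore a i e) Q T s \<longleftrightarrow> 1 + ncost i + ncost e \<le> T \<and>
     Q (s\<lparr>narr := (narr s)(a := (narr s a)(nval i s := nval e s))\<rparr>)"
  unfolding wp_def by (blast intro: exec.intros dest: exec_deterministic[OF exec.NStore])

lemma wp_RAssign: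
  "wp (RAssign x e) Q T s \<longleftrightarrow> 1 + rcost e \<le> T \<and> Q (s\<lparr>rvar := (rvar s)(x := rval e s)\<rparr>)"
  unfolding wp_def by (blast intro: exec.intros dest: exec_deterministic[OF exec.RAssign])

lemma wp_Seq: "wp c (wp c' Q T') T s \<Longrightarrow> 1 + T + T' \<le> T'' \<Longrightarrow> wp (Seq c c') Q T'' s"
proof -
  assume "wp c (wp c' Q T') T s" and le: "1 + T + T' \<le> T''"
  then obtain t s1 t' s2 where "exec c s t s1" "t \<le> T" "exec c' s1 t' s2" "t' \<le> T'" "Q s2"
    unfolding wp_def by blast
  then show "wp (Seq c c') Q T'' s"
    using le exec.Seq[of c s t s1 c' t' s2] by (intro wpI[of _ _ "1 + t + t'" s2]) auto
qed

text \<open>The cost of the head is known exactly: one step for \<open>Seq\<close>, one for the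
  assignment, and the expression. Subtracting it from the budget leaves no intermediate bound to
  guess.\<close>

lemma wp_Seq_NAssign:
  assumes "2 + ncost e \<le> T" "wp c Q (T - (2 + ncost e)) (s\<lparr>nvar := (nvar s)(x := nval e s)\<rparr>)"
  shows "wp (Seq (NAssign x e) c) Q T s"
  by (rule wp_Seq[where T = "1 + ncost e" and T' = "T - (2 + ncost e)"])
    (use assms in \<open>simp_all add: wp_NAssign\<close>)

lemma wp_Seq_NStore:
  assumes "2 + ncost i + ncost e \<le> T" "wp c Q (T - (2 + ncost i + ncost e))
    (s\<lparr>narr := (narr s)(a := (narr s a)(nval i s := nval e s))\<rparr>)"
  shows "wp (Seq (NStore a i e) c) Q T s"
  by (rule wp_Seq[where T = "1 + ncost i + ncost e" and T' = "T - (2 + ncost i + ncost e)"])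
    (use assms in \<open>simp_all add: wp_NStore\<close>)

lemma wp_Seq_RAssign:
  assumes "2 + rcost e \<le> T" "wp c Q (T - (2 + rcost e)) (s\<lparr>rvar := (rvar s)(x := rval e s)\<rparr>)"
  shows "wp (Seq (RAssign x e) c) Q T s"
  by (rule wp_Seq[where T = "1 + rcost e" and T' = "T - (2 + rcost e)"])
    (use assms in \<open>simp_all add: wp_RAssign\<close>)

lemma wp_Cond:
  assumes "1 + bcost b \<le> T"
    and "bval b s \<Longrightarrow> wp c Q (T - (1 + bcost b)) s"
    and "\<not> bval b s \<Longrightarrow> wp c' Q (T - (1 + bcost b)) s"
  shows "wp (Cond b c c') Q T s"
proof (cases "bval b s")
  case True
  with assms(2) obtain t s' where "exec c s t s'" "t \<le> T - (1 + bcost b)" "Q s'"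
    unfolding wp_def by blast
  with True assms(1) show ?thesis by (intro wpI[OF exec.CondTrue]) auto
next
  case False
  with assms(3) obtain t s' where "exec c' s t s'" "t \<le> T - (1 + bcost b)" "Q s'"
    unfolding wp_def by blast
  with False assms(1) show ?thesis by (intro wpI[OF exec.CondFalse]) auto
qed

text \<open>The measure \<open>\<mu>\<close> bounds the number of iterations, \<open>T\<close> the
  cost of one body. The factor \<open>Suc (\<mu> s)\<close> pays for the final failing test as
  well.\<close>

lemma wp_While:
  fixes \<mu> :: "state \<Rightarrow> nat"
  assumes "I s"
    and step: "\<And>s. I s \<Longrightarrow> bval b s \<Longrightarrow> wp c (\<lambda>s'. I s' \<and> \<mu> s' < \<mu> s) T s"
    and exit: "\<And>s. I s \<Longrightarrow> \<not> bval b s \<Longrightarrow> Q s"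
    and time: "Suc (\<mu> s) * (T + 1 + bcost b) \<le> T'"
  shows "wp (While b c) Q T' s"
proof -
  have "wp (While b c) Q (Suc (\<mu> s) * (T + 1 + bcost b)) s" if "I s" for s
    using that
  proof (induction "\<mu> s" arbitrary: s rule: less_induct)
    case less
    show ?case
    proof (cases "bval b s")
      case True
      obtain t s1 where 1: "exec c s t s1" "t \<le> T" "I s1" "\<mu> s1 < \<mu> s"
        using step[OF less.prems True] unfolding wp_def by blast
      obtain t' s2 where 2: "exec (While b c) s1 t' s2" "Q s2"
        "t' \<le> Suc (\<mu> s1) * (T + 1 + bcost b)"
        using less.hyps[OF 1(4,3)] unfolding wp_def by blast
      have "t' \<le> \<mu> s * (T + 1 + bcost b)"
        using 2(3) 1(4) by (meson Suc_leI le_trans mult_le_mono1)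
      then show ?thesis
        using exec.WhileTrue[OF True 1(1) 2(1)] 1(2) 2(2)
        by (intro wpI[of _ _ "1 + bcost b + t + t'" s2]) auto
    next
      case False
      then show ?thesis
        by (intro wpI[OF exec.WhileFalse[OF False]]) (auto intro: exit less.prems)
    qed
  qed
  from wp_conseq[OF this[OF \<open>I s\<close>] _ time] show ?thesis by blast
qed

definition For :: "vname \<Rightarrow> nexp \<Rightarrow> com \<Rightarrow> com" where
  "For v e c = Seq (NAssign v (NConst 0))
     (While (NLess (NVar v) e) (Seq c (NAssign v (NAdd (NVar v) (NConst 1)))))"

text \<open>The bound \<open>e\<close> is evaluated anew in every test, so the invariant has to fix
  its value, and the body has to preserve the counter. One round costs at most
  \<open>T + 11\<close>: the body, \<open>5\<close> for increment and \<open>Seq\<close>, and at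
  most \<open>6\<close> for the test. Another \<open>3\<close> for the initialisation gives
  \<open>14\<close>.\<close>

lemma wp_For:
  assumes init: "I 0 (s\<lparr>nvar := (nvar s)(v := 0)\<rparr>)"
    and body: "\<And>i s. i < N \<Longrightarrow> I i s \<Longrightarrow> nvar s v = i \<Longrightarrow>
      wp c (\<lambda>s'. I (Suc i) (s'\<lparr>nvar := (nvar s')(v := Suc i)\<rparr>) \<and> nvar s' v = i) T s"
    and bound: "\<And>i s. I i s \<Longrightarrow> nval e s = N"
    and cost: "ncost e \<le> 3"
    and exit: "\<And>s. I N s \<Longrightarrow> Q s"
    and time: "Suc N * (T + 14) \<le> T'"
  shows "wp (For v e c) Q T' s"
proof -
  let ?J = "\<lambda>s. nvar s v \<le> N \<and> I (nvar s v) s"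
  have T': "Suc N * (T + 11) + 3 \<le> T'"
    using time by (simp add: distrib_left)
  show ?thesis
    unfolding For_def
  proof (rule wp_Seq_NAssign)
    show "2 + ncost (NConst 0) \<le> T'" using T' by simp
    show "wp (While (NLess (NVar v) e) (Seq c (NAssign v (NAdd (NVar v) (NConst 1))))) Q
        (T' - (2 + ncost (NConst 0))) (s\<lparr>nvar := (nvar s)(v := nval (NConst 0) s)\<rparr>)"
    proof (rule wp_While[where I = ?J and \<mu> = "\<lambda>s. N - nvar s v" and T = "T + 5"])
      fix s assume J: "?J s" and "bval (NLess (NVar v) e) s"
      then have lt: "nvar s v < N" using bound[of "nvar s v" s] by simp
      show "wp (Seq c (NAssign v (NAdd (NVar v) (NConst 1))))
          (\<lambda>s'. ?J s' \<and> N - nvar s' v < N - nvar s v) (T + 5) s"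
        by (rule wp_Seq[where T = T and T' = 4], rule wp_conseq[OF body[OF lt, of s]])
          (use J lt in \<open>auto simp: wp_NAssign\<close>)
    next
      fix s assume J: "?J s" and "\<not> bval (NLess (NVar v) e) s"
      then have "nvar s v = N" using bound[of "nvar s v" s] by simp
      with J exit show "Q s" by auto
    next
      have "Suc N * (T + 5 + 1 + bcost (NLess (NVar v) e)) \<le> Suc N * (T + 11)"
        using cost by (intro mult_le_mono2) simp
      with T' show "Suc (N - nvar (s\<lparr>nvar := (nvar s)(v := nval (NConst 0) s)\<rparr>) v) *
          (T + 5 + 1 + bcost (NLess (NVar v) e)) \<le> T' - (2 + ncost (NConst 0))"
        by simp
    qed (use init in simp)
  qed
qed

section \<open>Frame rule: cells a program can write\<close>

primrec nmod :: "com \<Rightarrow> vname set" where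
  "nmod Skip = {}"
| "nmod (NAssign x e) = {x}"
| "nmod (NStore a i e) = {}"
| "nmod (RAssign x e) = {}"
| "nmod (RStore a i e) = {}"
| "nmod (Seq c c') = nmod c \<union> nmod c'"
| "nmod (Cond b c c') = nmod c \<union> nmod c'"
| "nmod (While b c) = nmod c"

primrec namod :: "com \<Rightarrow> vname set" where
  "namod Skip = {}"
| "namod (NAssign x e) = {}"
| "namod (NStore a i e) = {a}"
| "namod (RAssign x e) = {}"
| "namod (RStore a i e) = {}"
| "namod (Seq c c') = namod c \<union> namod c'"
| "namod (Cond b c c') = namod c \<union> namod c'"
| "namod (While b c) = namod c"

primrec rmod :: "com \<Rightarrow> vname set" where
  "rmod Skip = {}"
| "rmod (NAssign x e) = {}"
| "rmod (NStore a i e) = {}"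
| "rmod (RAssign x e) = {x}"
| "rmod (RStore a i e) = {}"
| "rmod (Seq c c') = rmod c \<union> rmod c'"
| "rmod (Cond b c c') = rmod c \<union> rmod c'"
| "rmod (While b c) = rmod c"

primrec ramod :: "com \<Rightarrow> vname set" where
  "ramod Skip = {}"
| "ramod (NAssign x e) = {}"
| "ramod (NStore a i e) = {}"
| "ramod (RAssign x e) = {}"
| "ramod (RStore a i e) = {a}"
| "ramod (Seq c c') = ramod c \<union> ramod c'"
| "ramod (Cond b c c') = ramod c \<union> ramod c'"
| "ramod (While b c) = ramod c"

definition unmodified :: "com \<Rightarrow> state \<Rightarrow> state \<Rightarrow> bool" where
  "unmodified c s s' \<longleftrightarrow>
     (\<forall>x. x \<notin> nmod c \<longrightarrow> nvar s' x = nvar s x) \<and> (\<forall>a. a \<notin> namod c \<longrightarrow> narr s' a = narr s a) \<and>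
     (\<forall>x. x \<notin> rmod c \<longrightarrow> rvar s' x = rvar s x) \<and> (\<forall>a. a \<notin> ramod c \<longrightarrow> rarr s' a = rarr s a)"

lemma exec_unmodified: "exec c s t s' \<Longrightarrow> unmodified c s s'"
  by (induction rule: exec.induct) (simp_all add: unmodified_def)

text \<open>Specifications of subprograms then need to mention only what changes; everything outside
  the write sets is carried over by \<open>unmodified\<close>.\<close>

lemma wp_frame:
  assumes "wp c Q T s" "\<And>s'. Q s' \<Longrightarrow> unmodified c s s' \<Longrightarrow> Q' s'" "T \<le> T'"
  shows "wp c Q' T' s"
  using assms exec_unmodified unfolding wp_def by (meson order_trans)

section \<open>The program\<close>

definition nequal :: "nexp \<Rightarrow> nexp \<Rightarrow> bexp" where
  "nequal e f = BAnd (BNot (NLess e f)) (BNot (NLess f e))"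

lemma bval_nequal: "bval (nequal e f) s \<longleftrightarrow> nval e s = nval f s"
  by (auto simp: nequal_def)

lemma bcost_nequal: "bcost (nequal e f) = 5 + 2 * ncost e + 2 * ncost f"
  by (simp add: nequal_def)

text \<open>The machine has no multiplication, so the row offset \<open>i * n\<close> is looked up
  in the table \<open>row\<close>, which \<open>row_prog\<close> fills by repeated addition.\<close>

definition dist_exp :: "vname \<Rightarrow> vname \<Rightarrow> rexp" where
  "dist_exp x y = RArr ''dist'' (NAdd (NArr ''row'' (NVar x)) (NVar y))"

lemma rcost_dist_exp: "rcost (dist_exp x y) = 5"
  by (simp add: dist_exp_def)

definition row_prog :: com where
  "row_prog = For ''i'' (NVar ''n'')
     (Seq (NStore ''row'' (NVar ''i'') (NVar ''a''))
          (NAssign ''a'' (NAdd (NVar ''a'') (NVar ''n''))))"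

definition divmod_prog :: "vname \<Rightarrow> com" where
  "divmod_prog u = Seq (NAssign ''q'' (NConst 0))
     (Seq (While (BNot (NLess (NVar ''y'') (NVar ''n'')))
            (Seq (NAssign ''y'' (NSub (NVar ''y'') (NVar ''n'')))
                 (NAssign ''q'' (NAdd (NVar ''q'') (NConst 1)))))
     (Seq (NAssign u (NVar ''y'')) (NAssign ''y'' (NVar ''q''))))"

text \<open>The label of \<open>u\<close> is saved in \<open>c\<close> first, since
  \<open>split_at\<close> compares with the old labelling while \<open>L\<close> is overwritten in
  place.\<close>

definition split_prog :: com where
  "split_prog = Seq (NAssign ''c'' (NArr ''L'' (NVar ''u'')))
     (For ''i'' (NVar ''n'')
       (Cond (BAnd (nequal (NArr ''L'' (NVar ''i'')) (NVar ''c''))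
               (RLess (dist_exp ''u'' ''w'') (dist_exp ''u'' ''i'')))
          (NStore ''L'' (NVar ''i'') (NAdd (NVar ''t'') (NConst 1)))
          Skip))"

definition labels_prog :: com where
  "labels_prog = Seq (For ''i'' (NVar ''n'') (NStore ''L'' (NVar ''i'') (NConst 0)))
     (For ''t'' (NSub (NVar ''k'') (NConst 1))
       (Seq (divmod_prog ''u'') (Seq (divmod_prog ''w'') split_prog)))"

text \<open>The variable \<open>zero\<close> is never assigned and stands in for the constant
  \<open>0\<close>, which programs cannot contain.\<close>

definition diam_prog :: com where
  "diam_prog = Seq (RAssign ''max'' (RVar ''zero''))
     (For ''i'' (NVar ''n'') (For ''j'' (NVar ''n'')
       (Cond (BAnd (nequal (NArr ''L'' (NVar ''i'')) (NVar ''t''))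
               (BAnd (nequal (NArr ''L'' (NVar ''j'')) (NVar ''t''))
                 (RLess (RVar ''max'') (dist_exp ''i'' ''j''))))
          (RAssign ''max'' (dist_exp ''i'' ''j''))
          Skip)))"

definition cost_prog :: com where
  "cost_prog = Seq (RAssign ''cost'' (RVar ''zero''))
     (For ''t'' (NVar ''k'')
       (Seq diam_prog (RAssign ''cost'' (RAdd (RVar ''cost'') (RVar ''max'')))))"

text \<open>For code \<open>0\<close> there is no meaningful \<open>best\<close> yet; the test
  \<open>0 < x\<close> makes this code accepted unconditionally.\<close>

definition update_prog :: com where
  "update_prog = Cond (BAnd (NLess (NConst 0) (NVar ''x'')) (BNot (RLess (RVar ''cost'') (RVar ''best''))))
     Skip
     (Seq (RAssign ''best'' (RVar ''cost''))
       (For ''i'' (NVar ''n'') (NStore ''label'' (NVar ''i'') (NArr ''L'' (NVar ''i'')))))"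

definition round_prog :: com where
  "round_prog = Seq (NAssign ''y'' (NVar ''x''))
     (Seq labels_prog (Seq cost_prog (Seq update_prog
       (NAssign ''x'' (NAdd (NVar ''x'') (NConst 1))))))"

text \<open>
  Replacing \<open>k\<close> by \<open>min n k\<close> keeps the time bounded by a power of \<open>n\<close> even if \<open>k > n\<close>, in particular for
  \<open>n = 1\<close>. Once the digits of \<open>x\<close> have been consumed, \<open>y\<close> holds \<open>x div n ^ (2 * (k - 1))\<close>; it becomes
  nonzero exactly when all codes have been tried, so the number of codes need not be computed.
\<close>
definition msd_prog :: com where
  "msd_prog = Seq (Cond (NLess (NVar ''n'') (NVar ''k'')) (NAssign ''k'' (NVar ''n'')) Skip)
     (Seq row_prog (While (NLess (NVar ''y'') (NConst 1)) round_prog))"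

section \<open>Correctness and running time of the subprograms\<close>

definition input_ok :: "nat \<Rightarrow> nat \<Rightarrow> (nat \<Rightarrow> nat \<Rightarrow> real) \<Rightarrow> state \<Rightarrow> bool" where
  "input_ok n k D s \<longleftrightarrow> nvar s ''n'' = n \<and> nvar s ''k'' = k \<and> rvar s ''zero'' = 0 \<and>
     (\<forall>i<n. narr s ''row'' i = i * n) \<and> (\<forall>i<n. \<forall>j<n. rarr s ''dist'' (i * n + j) = D i j)"

lemma input_ok_unmodified:
  assumes "input_ok n k D s" "unmodified c s s'"
    and "''n'' \<notin> nmod c" "''k'' \<notin> nmod c" "''zero'' \<notin> rmod c" "''row'' \<notin> namod c" "''dist'' \<notin> ramod c"
  shows "input_ok n k D s'"
  using assms by (simp add: input_ok_def unmodified_def)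

lemma rval_dist_exp:
  "input_ok n k D s \<Longrightarrow> nvar s x < n \<Longrightarrow> nvar s y < n \<Longrightarrow>
    rval (dist_exp x y) s = D (nvar s x) (nvar s y)"
  by (simp add: input_ok_def dist_exp_def)

lemma wp_row_prog:
  assumes "0 < n" "nvar s ''n'' = n" "nvar s ''a'' = 0"
  shows "wp row_prog (\<lambda>s'. \<forall>i<n. narr s' ''row'' i = i * n) (60 * n) s"
  unfolding row_prog_def
  by (rule wp_For[where N = n and T = 10 and
        I = "\<lambda>i s. nvar s ''n'' = n \<and> nvar s ''a'' = i * n \<and> (\<forall>j<i. narr s ''row'' j = j * n)"])
    (use assms in \<open>auto simp: wp_NAssign less_Suc_eq intro!: wp_Seq_NStore\<close>)

lemma wp_divmod_prog:
  assumes "0 < n" "nvar s ''n'' = n" "nvar s ''y'' = v" "u \<noteq> ''y''" "u \<noteq> ''q''"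
  shows "wp (divmod_prog u) (\<lambda>s'. nvar s' ''y'' = v div n \<and> nvar s' u = v mod n) (50 * Suc v) s"
  unfolding divmod_prog_def
proof (intro wp_Seq_NAssign)
  \<comment> \<open>The usual invariant of division by repeated subtraction. The remaining
    \<open>y\<close> serves as the measure, which gives a bound linear in \<open>v\<close>.\<close>
  let ?I = "\<lambda>s. nvar s ''n'' = n \<and> nvar s ''q'' * n + nvar s ''y'' = v"
  let ?s = "s\<lparr>nvar := (nvar s)(''q'' := nval (NConst 0) s)\<rparr>"
  let ?w = "Seq (NAssign ''y'' (NSub (NVar ''y'') (NVar ''n'')))
    (NAssign ''q'' (NAdd (NVar ''q'') (NConst 1)))"
  show "wp (Seq (While (BNot (NLess (NVar ''y'') (NVar ''n''))) ?w)
      (Seq (NAssign u (NVar ''y'')) (NAssign ''y'' (NVar ''q''))))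
    (\<lambda>s'. nvar s' ''y'' = v div n \<and> nvar s' u = v mod n) (50 * Suc v - (2 + ncost (NConst 0))) ?s"
  proof (rule wp_Seq[where T = "Suc v * 15" and T' = 5],
      rule wp_While[where I = ?I and \<mu> = "\<lambda>s. nvar s ''y''" and T = 9])
    fix s assume I: "?I s" and "bval (BNot (NLess (NVar ''y'') (NVar ''n''))) s"
    then show "wp ?w (\<lambda>s'. ?I s' \<and> nvar s' ''y'' < nvar s ''y'') 9 s"
      using \<open>0 < n\<close> by (intro wp_Seq_NAssign) (auto simp: wp_NAssign algebra_simps)
  next
    fix s assume I: "?I s" and "\<not> bval (BNot (NLess (NVar ''y'') (NVar ''n''))) s"
    then have "nvar s ''y'' < n" by simp
    then have "v div n = nvar s ''q''" "v mod n = nvar s ''y''"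
      using I by (auto simp: div_add1_eq)
    then show "wp (Seq (NAssign u (NVar ''y'')) (NAssign ''y'' (NVar ''q'')))
        (\<lambda>s'. nvar s' ''y'' = v div n \<and> nvar s' u = v mod n) 5 s"
      using assms(4,5) by (intro wp_Seq_NAssign) (auto simp: wp_NAssign)
  qed (use assms in auto)
qed simp

lemma wp_split_prog:
  assumes "0 < n" and ok: "input_ok n k D s" and f: "\<And>i. i < n \<Longrightarrow> narr s ''L'' i = f i"
    and uw: "nvar s ''u'' = u" "nvar s ''w'' = w" "u < n" "w < n" "nvar s ''t'' = t"
  shows "wp split_prog (\<lambda>s'. \<forall>i<n. narr s' ''L'' i = split_at D u w (Suc t) f i) (110 * n) s"
  unfolding split_prog_def
proof (rule wp_Seq_NAssign)
  let ?I = "\<lambda>i s. input_ok n k D s \<and> nvar s ''u'' = u \<and> nvar s ''w'' = w \<and> nvar s ''t'' = t \<and>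
    nvar s ''c'' = f u \<and>
    (\<forall>j<n. narr s ''L'' j = (if j < i then split_at D u w (Suc t) f j else f j))"
  show "wp (For ''i'' (NVar ''n'')
       (Cond (BAnd (nequal (NArr ''L'' (NVar ''i'')) (NVar ''c''))
               (RLess (dist_exp ''u'' ''w'') (dist_exp ''u'' ''i'')))
          (NStore ''L'' (NVar ''i'') (NAdd (NVar ''t'') (NConst 1)))
          Skip)) (\<lambda>s'. \<forall>i<n. narr s' ''L'' i = split_at D u w (Suc t) f i)
     (110 * n - (2 + ncost (NArr ''L'' (NVar ''u''))))
     (s\<lparr>nvar := (nvar s)(''c'' := nval (NArr ''L'' (NVar ''u'')) s)\<rparr>)"
  proof (rule wp_For[where N = n and T = 35 and I = ?I])
    fix i s assume i: "i < n" "?I i s" "nvar s ''i'' = i"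
    then have "rval (dist_exp ''u'' ''w'') s = D u w" "rval (dist_exp ''u'' ''i'') s = D u i"
      using uw(3,4) rval_dist_exp[of n k D s "''u''" "''w''"]
        rval_dist_exp[of n k D s "''u''" "''i''"] by auto
    with i show "wp (Cond (BAnd (nequal (NArr ''L'' (NVar ''i'')) (NVar ''c''))
               (RLess (dist_exp ''u'' ''w'') (dist_exp ''u'' ''i'')))
          (NStore ''L'' (NVar ''i'') (NAdd (NVar ''t'') (NConst 1)))
          Skip) (\<lambda>s'. ?I (Suc i) (s'\<lparr>nvar := (nvar s')(''i'' := Suc i)\<rparr>) \<and> nvar s' ''i'' = i) 35 s"
      by (intro wp_Cond)
        (auto simp: bcost_nequal bval_nequal rcost_dist_exp wp_NStore wp_Skip input_ok_def
          split_at_def less_Suc_eq)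
  qed (use assms in \<open>auto simp: input_ok_def\<close>)
qed (use \<open>0 < n\<close> in simp)


section \<open>Computing the labelling of a code\<close>

definition code_label :: "(nat \<Rightarrow> nat \<Rightarrow> real) \<Rightarrow> nat \<Rightarrow> nat \<Rightarrow> nat \<Rightarrow> nat \<Rightarrow> nat" where
  "code_label D n x t = labels D (digit n x) t"

definition code_cost :: "(nat \<Rightarrow> nat \<Rightarrow> real) \<Rightarrow> nat \<Rightarrow> nat \<Rightarrow> nat \<Rightarrow> real" where
  "code_cost D n k x = (\<Sum>t<k. class_diam D n (code_label D n x (k - 1)) t)"

text \<open>Split \<open>t\<close> consumes the digits \<open>2 * t\<close> and
  \<open>2 * t + 1\<close>, so the quotient left in \<open>y\<close> advances by two powers of
  \<open>n\<close>. Quotients never exceed \<open>x\<close>, which bounds every division. The final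
  \<open>y\<close> is part of the postcondition because the main loop tests it.\<close>

lemma wp_labels_prog:
  assumes "0 < n" "0 < k" and ok: "input_ok n k D s" and y: "nvar s ''y'' = x"
  shows "wp labels_prog (\<lambda>s'. nvar s' ''y'' = x div n ^ (2 * (k - 1)) \<and>
    (\<forall>i<n. narr s' ''L'' i = code_label D n x (k - 1) i)) (300 * (k * (n + Suc x))) s"
  unfolding labels_prog_def
proof (rule wp_Seq)
  let ?I = "\<lambda>t s. input_ok n k D s \<and> nvar s ''y'' = x div n ^ (2 * t) \<and>
    (\<forall>i<n. narr s ''L'' i = code_label D n x t i)"
  let ?B = "Seq (divmod_prog ''u'') (Seq (divmod_prog ''w'') split_prog)"
  let ?Q = "\<lambda>s'. nvar s' ''y'' = x div n ^ (2 * (k - 1)) \<and>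
    (\<forall>i<n. narr s' ''L'' i = code_label D n x (k - 1) i)"
  have pow: "x div n ^ m div n = x div n ^ Suc m" for m
    by (simp add: div_mult2_eq[symmetric] mult.commute)
  have loop: "wp (For ''t'' (NSub (NVar ''k'') (NConst 1)) ?B) ?Q (k * (110 * n + 100 * Suc x + 30)) s"
    if "?I 0 s" for s
  proof (rule wp_For[where N = "k - 1" and T = "110 * n + 100 * Suc x + 10" and I = ?I])
    fix t s assume t: "t < k - 1" "?I t s" "nvar s ''t'' = t"
    let ?J1 = "\<lambda>s. input_ok n k D s \<and> nvar s ''t'' = t \<and> nvar s ''y'' = x div n ^ (2 * t + 1) \<and>
      nvar s ''u'' = digit n x (2 * t) \<and> (\<forall>i<n. narr s ''L'' i = code_label D n x t i)"
    let ?J2 = "\<lambda>s. input_ok n k D s \<and> nvar s ''t'' = t \<and> nvar s ''y'' = x div n ^ (2 * Suc t) \<and>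
      nvar s ''u'' = digit n x (2 * t) \<and> nvar s ''w'' = digit n x (2 * t + 1) \<and>
      (\<forall>i<n. narr s ''L'' i = code_label D n x t i)"
    have n: "nvar s ''n'' = n" if "input_ok n k D s" for s
      using that by (simp add: input_ok_def)
    have step1: "wp (divmod_prog ''u'') ?J1 (50 * Suc x) s"
    proof (rule wp_frame[OF wp_divmod_prog[OF \<open>0 < n\<close> n refl]])
      show "input_ok n k D s" using t by simp
      fix s' assume "nvar s' ''y'' = nvar s ''y'' div n \<and> nvar s' ''u'' = nvar s ''y'' mod n"
        and un: "unmodified (divmod_prog ''u'') s s'"
      moreover have "input_ok n k D s'"
        by (rule input_ok_unmodified[OF _ un]) (use t in \<open>simp_all add: divmod_prog_def\<close>)
      ultimately show "?J1 s'"
        using t pow[of "2 * t"] by (simp add: unmodified_def divmod_prog_def digit_def)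
    qed (use t div_le_dividend in simp_all)
    have step2: "wp (divmod_prog ''w'') ?J2 (50 * Suc x) s" if J1: "?J1 s" for s
    proof (rule wp_frame[OF wp_divmod_prog[OF \<open>0 < n\<close> n refl]])
      show "input_ok n k D s" using J1 by simp
      fix s' assume "nvar s' ''y'' = nvar s ''y'' div n \<and> nvar s' ''w'' = nvar s ''y'' mod n"
        and un: "unmodified (divmod_prog ''w'') s s'"
      moreover have "input_ok n k D s'"
        by (rule input_ok_unmodified[OF _ un]) (use J1 in \<open>simp_all add: divmod_prog_def\<close>)
      moreover have "x div n ^ (2 * t + 1) div n = x div n ^ (2 * Suc t)"
        using pow[of "2 * t + 1"] by simp
      ultimately show "?J2 s'"
        using J1 by (simp add: unmodified_def divmod_prog_def digit_def)
    qed (use J1 div_le_dividend in simp_all)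
    have step3: "wp split_prog (\<lambda>s'. ?I (Suc t) (s'\<lparr>nvar := (nvar s')(''t'' := Suc t)\<rparr>) \<and>
        nvar s' ''t'' = t) (110 * n) s" if J2: "?J2 s" for s
    proof (rule wp_frame[OF wp_split_prog[OF \<open>0 < n\<close>, where f = "code_label D n x t"]])
      fix s' assume L: "\<forall>i<n. narr s' ''L'' i =
          split_at D (nvar s ''u'') (nvar s ''w'') (Suc (nvar s ''t'')) (code_label D n x t) i"
        and un: "unmodified split_prog s s'"
      have "input_ok n k D s'"
        by (rule input_ok_unmodified[OF _ un]) (use J2 in \<open>simp_all add: split_prog_def For_def\<close>)
      with L un J2 show "?I (Suc t) (s'\<lparr>nvar := (nvar s')(''t'' := Suc t)\<rparr>) \<and> nvar s' ''t'' = t"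
        by (simp add: unmodified_def split_prog_def For_def code_label_def input_ok_def)
    qed (use J2 \<open>0 < n\<close> in \<open>auto simp: digit_def\<close>)
    show "wp ?B (\<lambda>s'. ?I (Suc t) (s'\<lparr>nvar := (nvar s')(''t'' := Suc t)\<rparr>) \<and> nvar s' ''t'' = t)
        (110 * n + 100 * Suc x + 10) s"
      by (rule wp_Seq[OF wp_conseq[OF step1 wp_Seq[OF wp_conseq[OF step2 step3]]]]) auto
  next
    show "Suc (k - 1) * (110 * n + 100 * Suc x + 10 + 14) \<le> k * (110 * n + 100 * Suc x + 30)"
      using \<open>0 < k\<close> by (intro mult_le_mono) auto
  qed (use that in \<open>auto simp: input_ok_def\<close>)
  show "wp (For ''i'' (NVar ''n'') (NStore ''L'' (NVar ''i'') (NConst 0)))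
      (wp (For ''t'' (NSub (NVar ''k'') (NConst 1)) ?B) ?Q (k * (110 * n + 100 * Suc x + 30)))
      (40 * n) s"
  proof (rule wp_For[where N = n and T = 3 and I = "\<lambda>i s. input_ok n k D s \<and> nvar s ''y'' = x \<and>
        (\<forall>j<i. narr s ''L'' j = 0)"])
    fix s assume "input_ok n k D s \<and> nvar s ''y'' = x \<and> (\<forall>j<n. narr s ''L'' j = 0)"
    then show "wp (For ''t'' (NSub (NVar ''k'') (NConst 1)) ?B) ?Q
        (k * (110 * n + 100 * Suc x + 30)) s"
      by (intro loop) (simp add: code_label_def)
  qed (use assms in \<open>auto simp: input_ok_def wp_NStore less_Suc_eq\<close>)
  have "1 * (1 + 40 * n) \<le> k * (1 + 40 * n)"
    using \<open>0 < k\<close> by (intro mult_le_mono1) simp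
  then have "1 + 40 * n + k * (110 * n + 100 * Suc x + 30) \<le>
      k * ((1 + 40 * n) + (110 * n + 100 * Suc x + 30))"
    unfolding distrib_left[of k "1 + 40 * n"] mult_1 by (rule add_right_mono)
  also have "\<dots> \<le> k * (300 * (n + Suc x))"
    by (intro mult_le_mono2) simp
  finally show "1 + 40 * n + k * (110 * n + 100 * Suc x + 30) \<le> 300 * (k * (n + Suc x))"
    by (simp only: mult.left_commute)
qed

section \<open>Computing the cost of a labelling\<close>

text \<open>The pairs inside class \<open>t\<close> that the nested loops have already visited when
  they reach \<open>(i, j)\<close>: a lexicographic initial segment.\<close>

definition pairs_before :: "nat \<Rightarrow> (nat \<Rightarrow> nat) \<Rightarrow> nat \<Rightarrow> nat \<Rightarrow> nat \<Rightarrow> (nat \<times> nat) set" where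
  "pairs_before n f t i j =
     {(a, b). (a < i \<or> a = i \<and> b < j) \<and> a < n \<and> b < n \<and> f a = t \<and> f b = t}"

lemma finite_pairs_before: "finite (pairs_before n f t i j)"
  by (rule finite_subset[of _ "{..<n} \<times> {..<n}"]) (auto simp: pairs_before_def)

lemma pairs_before_simps:
  "pairs_before n f t 0 0 = {}"
  "pairs_before n f t (Suc i) 0 = pairs_before n f t i n"
  "pairs_before n f t n 0 = {(i, j). i < n \<and> j < n \<and> f i = t \<and> f j = t}"
  by (auto simp: pairs_before_def)

lemma pairs_before_Suc:
  "i < n \<Longrightarrow> j < n \<Longrightarrow> pairs_before n f t i (Suc j) =
    (if f i = t \<and> f j = t then insert (i, j) (pairs_before n f t i j) else pairs_before n f t i j)"
  by (auto simp: pairs_before_def less_Suc_eq)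

definition max_before :: "(nat \<Rightarrow> nat \<Rightarrow> real) \<Rightarrow> nat \<Rightarrow> (nat \<Rightarrow> nat) \<Rightarrow> nat \<Rightarrow> nat \<Rightarrow> nat \<Rightarrow> real" where
  "max_before D n f t i j = Max (insert 0 ((\<lambda>(i, j). D i j) ` pairs_before n f t i j))"

text \<open>The start of the double loop, the passage from the end of a row to the next one, and the
  end of the loop.\<close>

lemma max_before_simps:
  "max_before D n f t 0 0 = 0"
  "max_before D n f t (Suc i) 0 = max_before D n f t i n"
  "max_before D n f t n 0 = class_diam D n f t"
  by (simp_all add: max_before_def class_diam_def pairs_before_simps)

lemma max_before_Suc:
  assumes "i < n" "j < n"
  shows "max_before D n f t i (Suc j) =
    (if f i = t \<and> f j = t then max (D i j) (max_before D n f t i j) else max_before D n f t i j)"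
proof -
  let ?A = "(\<lambda>(i, j). D i j) ` pairs_before n f t i j"
  have "insert 0 (insert (D i j) ?A) = insert (D i j) (insert 0 ?A)" by (rule insert_commute)
  moreover have "Max (insert (D i j) (insert 0 ?A)) = max (D i j) (Max (insert 0 ?A))"
    by (rule Max_insert) (simp_all add: finite_pairs_before)
  ultimately have ins: "Max (insert 0 (insert (D i j) ?A)) = max (D i j) (Max (insert 0 ?A))"
    by (simp only:)
  show ?thesis
  proof (cases "f i = t \<and> f j = t")
    case True
    show ?thesis
      unfolding max_before_def pairs_before_Suc[OF assms] if_P[OF True] image_insert prod.case
      by (rule ins)
  next
    case False
    show ?thesis
      unfolding max_before_def pairs_before_Suc[OF assms] if_not_P[OF False] ..
  qed
qed

lemma wp_diam_prog:
  assumes "0 < n" and ok: "input_ok n k D s" and f: "\<And>i. i < n \<Longrightarrow> narr s ''L'' i = f i"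
    and t: "nvar s ''t'' = t"
  shows "wp diam_prog (\<lambda>s'. rvar s' ''max'' = class_diam D n f t) (500 * (n * n)) s"
  unfolding diam_prog_def
proof (rule wp_Seq_RAssign)
  let ?J = "\<lambda>s. input_ok n k D s \<and> (\<forall>i<n. narr s ''L'' i = f i) \<and> nvar s ''t'' = t"
  let ?I = "\<lambda>i s. ?J s \<and> rvar s ''max'' = max_before D n f t i 0"
  let ?I' = "\<lambda>i j s. ?J s \<and> nvar s ''i'' = i \<and> rvar s ''max'' = max_before D n f t i j"
  let ?C = "Cond (BAnd (nequal (NArr ''L'' (NVar ''i'')) (NVar ''t''))
               (BAnd (nequal (NArr ''L'' (NVar ''j'')) (NVar ''t''))
                 (RLess (RVar ''max'') (dist_exp ''i'' ''j''))))
          (RAssign ''max'' (dist_exp ''i'' ''j'')) Skip"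
  have n: "n \<le> n * n" using \<open>0 < n\<close> by simp
  show "wp (For ''i'' (NVar ''n'') (For ''j'' (NVar ''n'') ?C))
      (\<lambda>s'. rvar s' ''max'' = class_diam D n f t) (500 * (n * n) - (2 + rcost (RVar ''zero'')))
      (s\<lparr>rvar := (rvar s)(''max'' := rval (RVar ''zero'') s)\<rparr>)"
  proof (rule wp_For[where N = n and T = "60 * Suc n" and I = ?I])
    fix i s assume i: "i < n" "?I i s" "nvar s ''i'' = i"
    show "wp (For ''j'' (NVar ''n'') ?C)
        (\<lambda>s'. ?I (Suc i) (s'\<lparr>nvar := (nvar s')(''i'' := Suc i)\<rparr>) \<and> nvar s' ''i'' = i) (60 * Suc n) s"
    proof (rule wp_For[where N = n and T = 46 and I = "?I' i"])
      fix j s assume j: "j < n" "?I' i j s" "nvar s ''j'' = j"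
      then have "rval (dist_exp ''i'' ''j'') s = D i j"
        using i(1) rval_dist_exp[of n k D s "''i''" "''j''"] by auto
      with i(1) j show "wp ?C
          (\<lambda>s'. ?I' i (Suc j) (s'\<lparr>nvar := (nvar s')(''j'' := Suc j)\<rparr>) \<and> nvar s' ''j'' = j) 46 s"
        by (intro wp_Cond)
          (auto simp: bcost_nequal bval_nequal rcost_dist_exp wp_RAssign wp_Skip input_ok_def
            max_before_Suc)
    qed (use i in \<open>auto simp: input_ok_def max_before_simps\<close>)
  next
    show "Suc n * (60 * Suc n + 14) \<le> 500 * (n * n) - (2 + rcost (RVar ''zero''))"
    proof -
      \<comment> \<open>As \<open>n \<ge> 1\<close>, constants are absorbed into multiples of
        \<open>n\<close>; the product \<open>268 * n * n\<close> leaves room for the initial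
        assignment.\<close>
      have "Suc n * (60 * Suc n + 14) \<le> (2 * n) * (134 * n)"
        using \<open>0 < n\<close> by (intro mult_le_mono) simp_all
      with n \<open>0 < n\<close> show ?thesis by simp
    qed
  qed (use assms in \<open>auto simp: input_ok_def max_before_simps\<close>)
  show "2 + rcost (RVar ''zero'') \<le> 500 * (n * n)"
    unfolding rcost.simps using n \<open>0 < n\<close> by linarith
qed

lemma wp_cost_prog:
  assumes "0 < n" "0 < k" and ok: "input_ok n k D s" and f: "\<And>i. i < n \<Longrightarrow> narr s ''L'' i = f i"
  shows "wp cost_prog (\<lambda>s'. rvar s' ''cost'' = (\<Sum>t<k. class_diam D n f t)) (1500 * (k * (n * n))) s"
  unfolding cost_prog_def
proof (rule wp_Seq_RAssign)
  let ?I = "\<lambda>t s. input_ok n k D s \<and> (\<forall>i<n. narr s ''L'' i = f i) \<and>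
    rvar s ''cost'' = (\<Sum>t<t. class_diam D n f t)"
  have n: "1 \<le> n * n" "1 \<le> k * (n * n)" using \<open>0 < n\<close> \<open>0 < k\<close> by (simp_all add: Suc_le_eq)
  show "wp (For ''t'' (NVar ''k'') (Seq diam_prog (RAssign ''cost'' (RAdd (RVar ''cost'') (RVar ''max'')))))
    (\<lambda>s'. rvar s' ''cost'' = (\<Sum>t<k. class_diam D n f t))
    (1500 * (k * (n * n)) - (2 + rcost (RVar ''zero'')))
    (s\<lparr>rvar := (rvar s)(''cost'' := rval (RVar ''zero'') s)\<rparr>)"
  proof (rule wp_For[where N = k and T = "500 * (n * n) + 5" and I = ?I])
    fix t s assume t: "t < k" "?I t s" "nvar s ''t'' = t"
    have "wp diam_prog (\<lambda>s'. wp (RAssign ''cost'' (RAdd (RVar ''cost'') (RVar ''max'')))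
        (\<lambda>s'. ?I (Suc t) (s'\<lparr>nvar := (nvar s')(''t'' := Suc t)\<rparr>) \<and> nvar s' ''t'' = t) 4 s')
        (500 * (n * n)) s"
    proof (rule wp_frame[OF wp_diam_prog[OF \<open>0 < n\<close>, where k = k and D = D and f = f and t = t]])
      fix s' assume m: "rvar s' ''max'' = class_diam D n f t" and un: "unmodified diam_prog s s'"
      have "input_ok n k D s'"
        by (rule input_ok_unmodified[OF _ un]) (use t in \<open>simp_all add: diam_prog_def For_def\<close>)
      with un m t show "wp (RAssign ''cost'' (RAdd (RVar ''cost'') (RVar ''max'')))
        (\<lambda>s'. ?I (Suc t) (s'\<lparr>nvar := (nvar s')(''t'' := Suc t)\<rparr>) \<and> nvar s' ''t'' = t) 4 s'"
        by (simp add: unmodified_def diam_prog_def For_def wp_RAssign input_ok_def)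
    qed (use t in auto)
    then show "wp (Seq diam_prog (RAssign ''cost'' (RAdd (RVar ''cost'') (RVar ''max''))))
        (\<lambda>s'. ?I (Suc t) (s'\<lparr>nvar := (nvar s')(''t'' := Suc t)\<rparr>) \<and> nvar s' ''t'' = t)
        (500 * (n * n) + 5) s"
      by (rule wp_Seq) simp
  next
    have "Suc k * (500 * (n * n) + 5 + 14) \<le> (2 * k) * (520 * (n * n))"
      using n(1) \<open>0 < k\<close> by (intro mult_le_mono) linarith+
    then show "Suc k * (500 * (n * n) + 5 + 14) \<le> 1500 * (k * (n * n)) - (2 + rcost (RVar ''zero''))"
      using n(2) by simp
  qed (use assms in \<open>auto simp: input_ok_def\<close>)
  show "2 + rcost (RVar ''zero'') \<le> 1500 * (k * (n * n))"
    using n(2) by simp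
qed


lemma wp_update_prog:
  assumes "0 < n" and ok: "input_ok n k D s" and f: "\<And>i. i < n \<Longrightarrow> narr s ''L'' i = f i"
  shows "wp update_prog (\<lambda>s'.
    if 0 < nvar s ''x'' \<and> \<not> rvar s ''cost'' < rvar s ''best''
    then rvar s' ''best'' = rvar s ''best'' \<and> narr s' ''label'' = narr s ''label''
    else rvar s' ''best'' = rvar s ''cost'' \<and> (\<forall>i<n. narr s' ''label'' i = f i)) (60 * n) s"
  unfolding update_prog_def
proof (rule wp_Cond)
  let ?b = "BAnd (NLess (NConst 0) (NVar ''x'')) (BNot (RLess (RVar ''cost'') (RVar ''best'')))"
  let ?P = "\<lambda>s'. if 0 < nvar s ''x'' \<and> \<not> rvar s ''cost'' < rvar s ''best''
    then rvar s' ''best'' = rvar s ''best'' \<and> narr s' ''label'' = narr s ''label''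
    else rvar s' ''best'' = rvar s ''cost'' \<and> (\<forall>i<n. narr s' ''label'' i = f i)"
  assume b: "\<not> bval ?b s"
  let ?I = "\<lambda>i s'. input_ok n k D s' \<and> (\<forall>i<n. narr s' ''L'' i = f i) \<and>
    rvar s' ''best'' = rvar s ''cost'' \<and> (\<forall>j<i. narr s' ''label'' j = f j)"
  show "wp (Seq (RAssign ''best'' (RVar ''cost''))
       (For ''i'' (NVar ''n'') (NStore ''label'' (NVar ''i'') (NArr ''L'' (NVar ''i'')))))
     ?P (60 * n - (1 + bcost ?b)) s"
  proof (rule wp_Seq_RAssign, goal_cases)
    case 2
    show ?case
      by (rule wp_For[where N = n and T = 4 and I = ?I])
        (use assms b in \<open>auto simp: input_ok_def wp_NStore less_Suc_eq\<close>)
  qed (use \<open>0 < n\<close> in simp)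
qed (use \<open>0 < n\<close> in \<open>auto simp: wp_Skip\<close>)

section \<open>The exhaustive search over codes\<close>

text \<open>Search invariant after the first \<open>m\<close> codes. It is vacuous for
  \<open>m = 0\<close>, when \<open>best\<close> and \<open>label\<close> hold only initial
  values.\<close>

definition best_so_far :: "nat \<Rightarrow> nat \<Rightarrow> (nat \<Rightarrow> nat \<Rightarrow> real) \<Rightarrow> nat \<Rightarrow> state \<Rightarrow> bool" where
  "best_so_far n k D m s \<longleftrightarrow> (0 < m \<longrightarrow>
     (\<exists>x<m. (\<forall>i<n. narr s ''label'' i = code_label D n x (k - 1) i) \<and>
        rvar s ''best'' = code_cost D n k x \<and> (\<forall>x'<m. code_cost D n k x \<le> code_cost D n k x')))"

lemma wp_round_prog:
  assumes "0 < n" "0 < k" and ok: "input_ok n k D s" and x: "nvar s ''x'' = x"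
    and best: "best_so_far n k D x s"
  shows "wp round_prog (\<lambda>s'. input_ok n k D s' \<and> nvar s' ''x'' = Suc x \<and>
      nvar s' ''y'' = x div n ^ (2 * (k - 1)) \<and> best_so_far n k D (Suc x) s')
    (300 * (k * (n + Suc x)) + 1500 * (k * (n * n)) + 60 * n + 20) s"
proof -
  let ?f = "code_label D n x (k - 1)"
  let ?J0 = "\<lambda>s. input_ok n k D s \<and> nvar s ''x'' = x \<and> nvar s ''y'' = x \<and> best_so_far n k D x s"
  let ?J1 = "\<lambda>s. input_ok n k D s \<and> nvar s ''x'' = x \<and> best_so_far n k D x s \<and>
    nvar s ''y'' = x div n ^ (2 * (k - 1)) \<and> (\<forall>i<n. narr s ''L'' i = ?f i)"
  let ?J2 = "\<lambda>s. ?J1 s \<and> rvar s ''cost'' = code_cost D n k x"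
  let ?J3 = "\<lambda>s. input_ok n k D s \<and> nvar s ''x'' = x \<and> best_so_far n k D (Suc x) s \<and>
    nvar s ''y'' = x div n ^ (2 * (k - 1))"
  let ?Q = "\<lambda>s. input_ok n k D s \<and> nvar s ''x'' = Suc x \<and>
    nvar s ''y'' = x div n ^ (2 * (k - 1)) \<and> best_so_far n k D (Suc x) s"
  have step1: "wp labels_prog ?J1 (300 * (k * (n + Suc x))) s" if J0: "?J0 s" for s
  proof (rule wp_frame[OF wp_labels_prog[OF assms(1,2), where x = x]])
    fix s' assume L: "nvar s' ''y'' = x div n ^ (2 * (k - 1)) \<and> (\<forall>i<n. narr s' ''L'' i = ?f i)"
      and un: "unmodified labels_prog s s'"
    have "input_ok n k D s'"
      by (rule input_ok_unmodified[OF _ un])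
        (use J0 in \<open>simp_all add: labels_prog_def divmod_prog_def split_prog_def For_def\<close>)
    with L un J0 show "?J1 s'"
      by (simp add: unmodified_def best_so_far_def labels_prog_def divmod_prog_def split_prog_def For_def)
  qed (use J0 in simp_all)
  have step2: "wp cost_prog ?J2 (1500 * (k * (n * n))) s" if J1: "?J1 s" for s
  proof (rule wp_frame[OF wp_cost_prog[OF assms(1,2), where D = D and f = ?f]])
    fix s' assume cost: "rvar s' ''cost'' = (\<Sum>t<k. class_diam D n ?f t)"
      and un: "unmodified cost_prog s s'"
    have "input_ok n k D s'"
      by (rule input_ok_unmodified[OF _ un])
        (use J1 in \<open>simp_all add: cost_prog_def diam_prog_def For_def\<close>)
    with cost un J1 show "?J2 s'"
      by (simp add: unmodified_def best_so_far_def cost_prog_def diam_prog_def For_def code_cost_def)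
  qed (use J1 in simp_all)
  have step3: "wp update_prog ?J3 (60 * n) s" if J2: "?J2 s" for s
  proof (rule wp_frame[OF wp_update_prog[OF assms(1), where k = k and D = D and f = ?f]])
    fix s' assume upd: "if 0 < nvar s ''x'' \<and> \<not> rvar s ''cost'' < rvar s ''best''
        then rvar s' ''best'' = rvar s ''best'' \<and> narr s' ''label'' = narr s ''label''
        else rvar s' ''best'' = rvar s ''cost'' \<and> (\<forall>i<n. narr s' ''label'' i = ?f i)"
      and un: "unmodified update_prog s s'"
    have "input_ok n k D s'"
      by (rule input_ok_unmodified[OF _ un]) (use J2 in \<open>simp_all add: update_prog_def For_def\<close>)
    moreover have "best_so_far n k D (Suc x) s'"
    proof -
      have old: "\<exists>z<x. (\<forall>i<n. narr s ''label'' i = code_label D n z (k - 1) i) \<and>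
        rvar s ''best'' = code_cost D n k z \<and> (\<forall>x'<x. code_cost D n k z \<le> code_cost D n k x')"
        if "0 < x"
        using J2 that by (simp add: best_so_far_def)
      have "\<exists>z<Suc x. (\<forall>i<n. narr s' ''label'' i = code_label D n z (k - 1) i) \<and>
        rvar s' ''best'' = code_cost D n k z \<and>
        (\<forall>x'<Suc x. code_cost D n k z \<le> code_cost D n k x')"
      \<comment> \<open>Either the old minimiser survives, or \<open>x\<close> takes over because it
        is the first code or strictly better.\<close>
      proof (cases "0 < x \<and> \<not> code_cost D n k x < rvar s ''best''")
        case True
        then have new: "rvar s' ''best'' = rvar s ''best''" "narr s' ''label'' = narr s ''label''"
          using upd J2 by (simp_all split: if_splits)
        from True old obtain z where "z < x" "\<forall>i<n. narr s ''label'' i = code_label D n z (k - 1) i"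
          "rvar s ''best'' = code_cost D n k z" "\<forall>x'<x. code_cost D n k z \<le> code_cost D n k x'"
          by metis
        with True show ?thesis
          unfolding new by (intro exI[of _ z]) (simp add: less_Suc_eq)
      next
        case False
        then have new: "rvar s' ''best'' = code_cost D n k x" "\<forall>i<n. narr s' ''label'' i = ?f i"
          using upd J2 by (auto split: if_splits)
        have "code_cost D n k x \<le> code_cost D n k x'" if "x' < x" for x'
        proof -
          from that old obtain z where "rvar s ''best'' = code_cost D n k z"
            "\<forall>x'<x. code_cost D n k z \<le> code_cost D n k x'"
            by (metis gr_zeroI not_less_zero)
          moreover have "code_cost D n k x < rvar s ''best''" using False that by simp
          ultimately show ?thesis using that by fastforce
        qed
        with new show ?thesis
          by (intro exI[of _ x]) (simp add: less_Suc_eq)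
      qed
      then show ?thesis by (simp add: best_so_far_def)
    qed
    ultimately show "?J3 s'"
      using un J2 by (simp add: unmodified_def update_prog_def For_def)
  qed (use J2 in simp_all)
  have step4: "wp (NAssign ''x'' (NAdd (NVar ''x'') (NConst 1))) ?Q 4 s" if "?J3 s" for s
    using that by (simp add: wp_NAssign input_ok_def best_so_far_def)
  have main: "wp (Seq labels_prog (Seq cost_prog (Seq update_prog
        (NAssign ''x'' (NAdd (NVar ''x'') (NConst 1)))))) ?Q
      (300 * (k * (n + Suc x)) + 1500 * (k * (n * n)) + 60 * n + 7) s" if "?J0 s" for s
  proof (rule wp_Seq[OF wp_conseq[OF step1[OF that] _ order_refl]])
    show "wp (Seq cost_prog (Seq update_prog (NAssign ''x'' (NAdd (NVar ''x'') (NConst 1))))) ?Q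
      (1500 * (k * (n * n)) + 60 * n + 6) s" if J1: "?J1 s" for s
    proof (rule wp_Seq[OF wp_conseq[OF step2[OF J1] _ order_refl]])
      show "wp (Seq update_prog (NAssign ''x'' (NAdd (NVar ''x'') (NConst 1)))) ?Q (60 * n + 5) s"
        if J2: "?J2 s" for s
        by (rule wp_Seq[OF wp_conseq[OF step3[OF J2] step4 order_refl]]) simp_all
    qed simp_all
  qed simp_all
  show ?thesis
    unfolding round_prog_def
    by (rule wp_Seq_NAssign, simp, rule wp_conseq[OF main])
      (use ok x best in \<open>simp_all add: input_ok_def best_so_far_def\<close>)
qed

text \<open>All terms are compared with \<open>n ^ 3 * N\<close>. The codes \<open>0\<close> to
  \<open>N\<close> make \<open>Suc N\<close> rounds, and the failing test makes
  \<open>Suc (Suc N)\<close>; the summands \<open>1 + 3\<close> are the loop step and its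
  test.\<close>

lemma search_time:
  fixes n k N :: nat
  assumes "0 < n" "k \<le> n" "1 \<le> N"
  shows "Suc (Suc N) * (300 * (k * (n + Suc N)) + 1500 * (k * (n * n)) + 60 * n + 20 + 1 + 3)
    \<le> 8000 * (n ^ 3 * N\<^sup>2)"
proof -
  let ?B = "n ^ 3 * N"
  have n: "1 \<le> n" "n \<le> n * n" using assms(1) by simp_all
  have "n * n * 1 \<le> n * n * n" using n by (intro mult_le_mono2)
  then have n3: "n \<le> n ^ 3" "n * n \<le> n ^ 3" using n by (simp_all add: power3_eq_cube)
  have "x \<le> ?B" if "x \<le> n ^ 3" for x
    using mult_le_mono[OF that assms(3)] by simp
  then have B: "n \<le> ?B" "n * n \<le> ?B" "n ^ 3 \<le> ?B"
    using n3 by blast+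
  then have B': "1 \<le> ?B" "n * (n * n) \<le> ?B"
    using n(1) by (linarith, simp only: power3_eq_cube mult.assoc)
  have "n * N \<le> ?B" using n3(1) by (rule mult_le_mono1)
  have "k * (n + Suc N) \<le> n * (n + 2 * N)"
    using assms by (intro mult_le_mono) auto
  also have "\<dots> = n * n + 2 * (n * N)" by (simp add: algebra_simps)
  finally have "k * (n + Suc N) \<le> 3 * ?B" using B \<open>n * N \<le> ?B\<close> by linarith
  moreover have "k * (n * n) \<le> ?B"
    using mult_le_mono1[OF assms(2), of "n * n"] B'(2) by linarith
  ultimately have "300 * (k * (n + Suc N)) + 1500 * (k * (n * n)) + 60 * n + 20 + 1 + 3 \<le> 2500 * ?B"
    using B(1) B'(1) by linarith
  then have "Suc (Suc N) * (300 * (k * (n + Suc N)) + 1500 * (k * (n * n)) + 60 * n + 20 + 1 + 3)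
    \<le> (3 * N) * (2500 * ?B)"
    using assms(3) by (intro mult_le_mono) simp_all
  also have "\<dots> = 7500 * (n ^ 3 * N\<^sup>2)" by (simp add: power2_eq_square)
  finally show ?thesis by simp
qed

text \<open>The loop stops after the first code with a nonzero quotient, which is
  \<open>n ^ (2 * (K - 1))\<close> itself. One code beyond the required range is thus tried; it may
  win, which is harmless as every code yields a clustering, so \<open>x\<close> carries no
  bound.\<close>

lemma wp_msd_prog:
  assumes "0 < n" "0 < k"
  defines "K \<equiv> min n k"
  shows "wp msd_prog (\<lambda>s'. \<exists>x. (\<forall>i<n. narr s' ''label'' i = code_label D n x (K - 1) i) \<and>
      (\<forall>x'<n ^ (2 * (K - 1)). code_cost D n K x \<le> code_cost D n K x'))
    (9000 * n ^ (4 * k)) (msd_input n k D)"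
proof -
  let ?Q = "\<lambda>s'. \<exists>x. (\<forall>i<n. narr s' ''label'' i = code_label D n x (K - 1) i) \<and>
      (\<forall>x'<n ^ (2 * (K - 1)). code_cost D n K x \<le> code_cost D n K x')"
  have "0 < K" "K \<le> n" using assms by auto
  define N where "N = n ^ (2 * (K - 1))"
  have "1 \<le> N" using \<open>0 < n\<close> by (simp add: N_def)
  let ?T = "300 * (K * (n + Suc N)) + 1500 * (K * (n * n)) + 60 * n + 20"
  \<comment> \<open>The test variable \<open>y\<close> is nonzero only once code \<open>N\<close>
    has been processed, since \<open>x div N = 0\<close> for all smaller \<open>x\<close>.\<close>
  let ?I = "\<lambda>s. input_ok n K D s \<and> best_so_far n K D (nvar s ''x'') s \<and>
    (if nvar s ''y'' = 0 then nvar s ''x'' \<le> N else nvar s ''x'' = Suc N)"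
  have loop: "wp (While (NLess (NVar ''y'') (NConst 1)) round_prog) ?Q (8000 * (n ^ 3 * N\<^sup>2)) s"
    if I: "input_ok n K D s" "nvar s ''x'' = 0" "nvar s ''y'' = 0" for s
  proof (rule wp_While[where I = ?I and T = ?T and \<mu> = "\<lambda>s. Suc N - nvar s ''x''"])
    fix s assume s: "?I s" and "bval (NLess (NVar ''y'') (NConst 1)) s"
    then have x: "nvar s ''x'' \<le> N" by (simp split: if_splits)
    have "input_ok n K D s" "best_so_far n K D (nvar s ''x'') s" using s by simp_all
    note r = wp_round_prog[OF \<open>0 < n\<close> \<open>0 < K\<close> this(1) refl this(2), folded N_def]
    show "wp round_prog (\<lambda>s'. ?I s' \<and> Suc N - nvar s' ''x'' < Suc N - nvar s ''x'') ?T s"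
    proof (rule wp_conseq[OF r])
      fix s' assume s': "input_ok n K D s' \<and> nvar s' ''x'' = Suc (nvar s ''x'') \<and>
        nvar s' ''y'' = nvar s ''x'' div N \<and> best_so_far n K D (Suc (nvar s ''x'')) s'"
      have "nvar s ''x'' div N = 0 \<longleftrightarrow> nvar s ''x'' \<noteq> N"
        using x \<open>1 \<le> N\<close> by (auto simp: div_eq_0_iff)
      with s' x show "?I s' \<and> Suc N - nvar s' ''x'' < Suc N - nvar s ''x''" by auto
    next
      have "K * (n + Suc (nvar s ''x'')) \<le> K * (n + Suc N)"
        using x by (intro mult_le_mono2) simp
      then show "300 * (K * (n + Suc (nvar s ''x''))) + 1500 * (K * (n * n)) + 60 * n + 20 \<le> ?T"
        by linarith
    qed
  next
    fix s assume "?I s" and "\<not> bval (NLess (NVar ''y'') (NConst 1)) s"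
    then have "best_so_far n K D (nvar s ''x'') s" "nvar s ''x'' = Suc N"
      by (auto split: if_splits)
    then obtain z where "\<forall>i<n. narr s ''label'' i = code_label D n z (K - 1) i"
      and "\<forall>x'<Suc N. code_cost D n K z \<le> code_cost D n K x'"
      by (auto simp: best_so_far_def)
    then show "?Q s"
      unfolding N_def[symmetric] by (intro exI[of _ z]) (simp add: less_Suc_eq)
  next
    show "Suc (Suc N - nvar s ''x'') * (?T + 1 + bcost (NLess (NVar ''y'') (NConst 1)))
      \<le> 8000 * (n ^ 3 * N\<^sup>2)"
      using search_time[OF \<open>0 < n\<close> \<open>K \<le> n\<close> \<open>1 \<le> N\<close>] I(2) by simp
  qed (use I in \<open>simp add: best_so_far_def\<close>)
  have rows: "wp (Seq row_prog (While (NLess (NVar ''y'') (NConst 1)) round_prog)) ?Q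
      (1 + 60 * n + 8000 * (n ^ 3 * N\<^sup>2)) (msd_input n K D)"
  proof (rule wp_Seq[OF wp_frame[OF wp_row_prog[OF \<open>0 < n\<close>] _ order_refl] order_refl])
    fix s' assume row: "\<forall>i<n. narr s' ''row'' i = i * n"
      and un: "unmodified row_prog (msd_input n K D) s'"
    have "i * n + j < n * n" if "i < n" "j < n" for i j
    proof -
      have "i * n + j < Suc i * n" using that by simp
      also have "\<dots> \<le> n * n" using that by (intro mult_le_mono1) simp
      finally show ?thesis .
    qed
    with row un show "wp (While (NLess (NVar ''y'') (NConst 1)) round_prog) ?Q
        (8000 * (n ^ 3 * N\<^sup>2)) s'"
      by (intro loop) (simp_all add: input_ok_def unmodified_def row_prog_def For_def msd_input_def)
  qed (simp_all add: msd_input_def)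
  \<comment> \<open>Capping \<open>k\<close> turns the initial state into the one for
    \<open>K\<close>, so the rest of the run concerns \<open>K\<close> only.\<close>
  have in_upd: "(msd_input n k D)\<lparr>nvar := (nvar (msd_input n k D))(''k'' := K)\<rparr> = msd_input n K D"
    by (simp add: msd_input_def)
  have run: "wp msd_prog ?Q (10 + (1 + 60 * n + 8000 * (n ^ 3 * N\<^sup>2))) (msd_input n k D)"
    unfolding msd_prog_def
  proof (rule wp_Seq)
    show "wp (Cond (NLess (NVar ''n'') (NVar ''k'')) (NAssign ''k'' (NVar ''n'')) Skip)
        (wp (Seq row_prog (While (NLess (NVar ''y'') (NConst 1)) round_prog)) ?Q
          (1 + 60 * n + 8000 * (n ^ 3 * N\<^sup>2))) 9 (msd_input n k D)"
    proof (rule wp_Cond)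
      assume "bval (NLess (NVar ''n'') (NVar ''k'')) (msd_input n k D)"
      then have "K = n" by (simp add: K_def msd_input_def)
      have "nval (NVar ''n'') (msd_input n k D) = K"
        by (simp add: \<open>K = n\<close> msd_input_def)
      then show "wp (NAssign ''k'' (NVar ''n''))
        (wp (Seq row_prog (While (NLess (NVar ''y'') (NConst 1)) round_prog)) ?Q
          (1 + 60 * n + 8000 * (n ^ 3 * N\<^sup>2)))
        (9 - (1 + bcost (NLess (NVar ''n'') (NVar ''k'')))) (msd_input n k D)"
        unfolding wp_NAssign using in_upd rows by simp
    next
      assume "\<not> bval (NLess (NVar ''n'') (NVar ''k'')) (msd_input n k D)"
      then have "K = k" by (simp add: K_def msd_input_def)
      with rows show "wp Skip
        (wp (Seq row_prog (While (NLess (NVar ''y'') (NConst 1)) round_prog)) ?Q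
          (1 + 60 * n + 8000 * (n ^ 3 * N\<^sup>2)))
        (9 - (1 + bcost (NLess (NVar ''n'') (NVar ''k'')))) (msd_input n k D)"
        by (simp add: wp_Skip)
    qed simp
  qed simp
  have "10 + (1 + 60 * n + 8000 * (n ^ 3 * N\<^sup>2)) \<le> 9000 * n ^ (4 * k)"
  proof -
    \<comment> \<open>The exponent is \<open>3 + 4 * (K - 1) = 4 * K - 1\<close>, below
      \<open>4 * k\<close> because \<open>K \<le> k\<close>.\<close>
    have "n ^ 3 * N\<^sup>2 = n ^ (3 + 2 * (K - 1) * 2)"
      by (simp only: N_def power_add power_mult)
    also have "\<dots> \<le> n ^ (4 * k)"
      using \<open>0 < n\<close> \<open>0 < K\<close> by (intro power_increasing) (auto simp: K_def)
    finally have "n ^ 3 * N\<^sup>2 \<le> n ^ (4 * k)" .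
    moreover have "n ^ 1 \<le> n ^ (4 * k)"
      using assms(1,2) by (intro power_increasing) auto
    ultimately show ?thesis using \<open>0 < n\<close> by simp
  qed
  then show ?thesis by (rule wp_conseq[OF run, rotated])
qed

section \<open>The search finds the cost of an optimal clustering\<close>

theorem mainTheorem1:
  shows "\<exists>(prog :: com) (a :: nat) (c :: nat).
    \<forall>(X :: 'a set) (d :: 'a \<Rightarrow> 'a \<Rightarrow> real) (p :: nat \<Rightarrow> 'a) (k :: nat).
      Metric_space X d \<and> finite X \<and> X \<noteq> {} \<and> bij_betw p {..<card X} X \<and> k \<ge> 1 \<longrightarrow>
      (\<exists>t s. exec prog (msd_input (card X) k (\<lambda>i j. d (p i) (p j))) t s
         \<and> msd_optimal X d k (msd_output p (card X) s)
         \<and> t \<le> a * card X ^ (c * k))"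
proof (rule exI[of _ msd_prog], rule exI[of _ 9000], rule exI[of _ 4], intro allI impI, elim conjE)
  fix X :: "'a set" and d :: "'a \<Rightarrow> 'a \<Rightarrow> real" and p :: "nat \<Rightarrow> 'a" and k :: nat
  assume metric: "Metric_space X d" and X: "finite X" "X \<noteq> {}"
    and bij: "bij_betw p {..<card X} X" and k: "1 \<le> k"
  define n where "n = card X"
  define D where "D = (\<lambda>i j. d (p i) (p j))"
  define K where "K = min n k"
  have "0 < n" using X by (simp add: n_def card_gt_0_iff)
  have bij: "bij_betw p {..<n} X" using bij by (simp add: n_def)
  have "0 < K" "K \<le> k" using \<open>0 < n\<close> k by (simp_all add: K_def)
  obtain t s x where exec: "exec msd_prog (msd_input n k D) t s" "t \<le> 9000 * n ^ (4 * k)"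
    and label: "\<And>i. i < n \<Longrightarrow> narr s ''label'' i = code_label D n x (K - 1) i"
    and best: "\<And>x'. x' < n ^ (2 * (K - 1)) \<Longrightarrow> code_cost D n K x \<le> code_cost D n K x'"
    using wp_msd_prog[OF \<open>0 < n\<close>, of k D] k unfolding wp_def K_def by auto
  have label_less: "code_label D n y (K - 1) i < K" for y i
    using labels_le[of D "digit n y" "K - 1" i] \<open>0 < K\<close> by (simp add: code_label_def)
  have cost: "sum_diam d (classes p n (code_label D n y (K - 1))) = code_cost D n K y" for y
    unfolding code_cost_def D_def
    by (rule sum_diam_classes)
      (use bij metric label_less in \<open>auto simp: bij_betw_def Metric_space_def D_def\<close>)
  obtain P where P: "msd_optimal X d k P"
    and merge: "\<And>S. S \<subseteq> P \<Longrightarrow> 2 \<le> card S \<Longrightarrow> (\<Sum>C\<in>S. diam d C) < diam d (\<Union>S)"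
    using minimal_optimal_clustering[OF X k] by blast
  have part: "partition_on X P" "card P \<le> k"
    using P by (auto simp: msd_optimal_def clustering_def)
  have "finite P" using part(1) X(1) by (auto simp: partition_on_def intro: finite_UnionD)
  have "finite C" "C \<noteq> {}" if "C \<in> P" for C
    using that part(1) X(1) by (auto simp: partition_on_def intro: finite_subset)
  \<comment> \<open>Clusters are nonempty and their sizes add up to \<open>n\<close>, so an optimum
    with at most \<open>k\<close> clusters has at most \<open>K = min n k\<close>.\<close>
  then have "(\<Sum>C\<in>P. 1) \<le> (\<Sum>C\<in>P. card C)"
    by (intro sum_mono) (simp add: Suc_le_eq card_gt_0_iff)
  also have "\<dots> = n"
    unfolding n_def by (rule product_partition[symmetric, OF part(1)]) fact
  finally have "card P \<le> n" by simp
  then have "card P \<le> K" using part(2) by (simp add: K_def)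
  obtain e where e: "\<And>j. e j < n" "coarsens p n (labels D e (K - 1)) P"
    "min (Suc (K - 1)) (card P) \<le> card (labels D e (K - 1) ` {..<n})"
    using labels_reach_partition[OF metric bij \<open>0 < n\<close> part(1) merge, of "K - 1"]
    unfolding D_def by blast
  have "card P \<le> card (labels D e (K - 1) ` {..<n})"
    using e(3) \<open>card P \<le> K\<close> \<open>0 < K\<close> by simp
  then have "classes p n (labels D e (K - 1)) = P"
    by (rule classes_eq_partition[OF bij part(1) \<open>finite P\<close> e(2)])
  \<comment> \<open>The labelling reads only \<open>2 * (K - 1)\<close> entries of \<open>e\<close>,
    so a code \<open>y\<close> within the searched range reproduces \<open>P\<close>.\<close>
  moreover obtain y where y: "y < n ^ (2 * (K - 1))" "\<forall>j<2 * (K - 1). digit n y j = e j"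
    using ex_digits[OF \<open>0 < n\<close>, of "2 * (K - 1)" e] e(1) by blast
  moreover have "code_label D n y (K - 1) = labels D e (K - 1)"
    unfolding code_label_def by (rule labels_cong) (use y(2) in simp)
  ultimately have P_cost: "sum_diam d P = code_cost D n K y"
    using cost[of y] by simp
  have out: "msd_output p n s = classes p n (code_label D n x (K - 1))"
    unfolding msd_output_classes by (rule classes_cong) (rule label)
  have "clustering X k (msd_output p n s)"
    unfolding out by (rule clustering_classes[OF bij]) (use label_less \<open>K \<le> k\<close> order_less_le_trans in blast)
  \<comment> \<open>The winner costs no more than code \<open>y\<close>, whose classes are the
    optimal \<open>P\<close>.\<close>
  moreover have "sum_diam d (msd_output p n s) \<le> sum_diam d P"
    unfolding out cost P_cost by (rule best[OF y(1)])
  ultimately have "msd_optimal X d k (msd_output p n s)"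
    using P unfolding msd_optimal_def by (meson order_trans)
  with exec show "\<exists>t s. exec msd_prog (msd_input (card X) k (\<lambda>i j. d (p i) (p j))) t s
      \<and> msd_optimal X d k (msd_output p (card X) s) \<and> t \<le> 9000 * card X ^ (4 * k)"
    unfolding n_def D_def by blast
qed

end
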